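(* If $a_1,\dots,a_g$ are distinct free generators (distinct elements of a free basis) of a free group $H$ and if $n_1,\dots,n_g$ are nonzero integers, then every solution in $H$ to $$x_1^2\cdots x_g^2=a_1^{2n_1}\cdots a_g^{2n_g}$$ is in the stabilizer class of the solution $\phi_0$ given by $x_i\phi_0=a_i^{n_i}$ for $1\le i\le g$.
   Context: A solution to $x_1^2\cdots x_g^2=T$ (with $T\in H$) is a homomorphism $\phi$ from the free group $\langle x_1,\dots,x_g\rangle$ on $x_1,\dots,x_g$ to $H$ with $(x_1\phi)^2\cdots(x_g\phi)^2=T$. Maps are written on the right and composed left to right. Two solutions $\phi_1,\phi_2$ of the same equation are in the same stabilizer class if $\phi_2=\sigma\phi_1$ (apply $\sigma$ first) for some automorphism $\sigma$ of the free group $\langle x_1,\dots,x_g\rangle$ with $(x_1^2\cdots x_g^2)\sigma=x_1^2\cdots x_g^2$. *)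

theory Defs
  imports "HOL-Algebra.Algebra"
begin

text \<open>The letter \<open>(b, True)\<close> stands for \<open>b\<close>, the letter \<open>(b, False)\<close> for its inverse.\<close>

definition reduced_words :: "'a set \<Rightarrow> ('a \<times> bool) list set" where
  "reduced_words B =
     {w. fst ` set w \<subseteq> B \<and> successively (\<lambda>(b, s) (c, t). \<not> (b = c \<and> s \<noteq> t)) w}"

definition word_value :: "('a, 'm) monoid_scheme \<Rightarrow> ('a \<times> bool) list \<Rightarrow> 'a" where
  "word_value G w =
     foldr (\<lambda>(b, s) r. (if s then b else inv\<^bsub>G\<^esub> b) \<otimes>\<^bsub>G\<^esub> r) w \<one>\<^bsub>G\<^esub>"

text \<open>\<open>G\<close> is a group that is free with free basis \<open>B\<close>: every element of \<open>G\<close> is the value of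
  exactly one reduced word in \<open>B\<close>.\<close>

definition free_basis :: "('a, 'm) monoid_scheme \<Rightarrow> 'a set \<Rightarrow> bool" where
  "free_basis G B \<longleftrightarrow>
     group G \<and> B \<subseteq> carrier G \<and> bij_betw (word_value G) (reduced_words B) (carrier G)"

text \<open>The product \<open>f 1 \<otimes> f 2 \<otimes> \<dots> \<otimes> f g\<close>, in this order; \<open>G\<close> need not be commutative, so
  \<open>finprod\<close> does not apply.\<close>

definition ordered_prod :: "('a, 'm) monoid_scheme \<Rightarrow> (nat \<Rightarrow> 'a) \<Rightarrow> nat \<Rightarrow> 'a" where
  "ordered_prod G f g = foldr (\<lambda>i r. f i \<otimes>\<^bsub>G\<^esub> r) [1..<Suc g] \<one>\<^bsub>G\<^esub>"

definition prod_squares :: "('a, 'm) monoid_scheme \<Rightarrow> (nat \<Rightarrow> 'a) \<Rightarrow> nat \<Rightarrow> 'a" where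
  "prod_squares G y g = ordered_prod G (\<lambda>i. y i [^]\<^bsub>G\<^esub> (2::nat)) g"

text \<open>In the next two definitions \<open>F\<close> is meant to be free on \<open>x 1, \<dots>, x g\<close>.\<close>

definition is_solution ::
  "('f, 'k) monoid_scheme \<Rightarrow> (nat \<Rightarrow> 'f) \<Rightarrow> nat \<Rightarrow> ('h, 'm) monoid_scheme \<Rightarrow> 'h \<Rightarrow> ('f \<Rightarrow> 'h) \<Rightarrow> bool"
  where
  "is_solution F x g H T \<phi> \<longleftrightarrow> \<phi> \<in> hom F H \<and> prod_squares H (\<lambda>i. \<phi> (x i)) g = T"

text \<open>Maps are applied on the left here, so a composite written \<open>\<sigma>\<phi>\<close> in left-to-right notation
  becomes \<open>\<phi> (\<sigma> w)\<close>. Only values on \<open>carrier F\<close> are compared, since elements of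
  \<open>hom F H\<close> are arbitrary outside it.\<close>

definition same_stabilizer_class ::
  "('f, 'k) monoid_scheme \<Rightarrow> (nat \<Rightarrow> 'f) \<Rightarrow> nat \<Rightarrow> ('f \<Rightarrow> 'h) \<Rightarrow> ('f \<Rightarrow> 'h) \<Rightarrow> bool"
  where
  "same_stabilizer_class F x g \<phi>\<^sub>1 \<phi>\<^sub>2 \<longleftrightarrow>
     (\<exists>\<sigma>\<in>auto F. \<sigma> (prod_squares F x g) = prod_squares F x g \<and>
        (\<forall>w\<in>carrier F. \<phi>\<^sub>2 w = \<phi>\<^sub>1 (\<sigma> w)))"

end

theory Submission
  imports Defs "HOL-Library.Z2"
begin

text \<open>Write the values of a solution as reduced words; this gives a subdivided bouquet of \<open>g\<close> circles
  whose edges are labelled by basis elements, and a closed path \<open>W\<close>, freely equal to the product of the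
  squares of the circles, that traverses every edge twice. Whenever two consecutive edges of
  \<open>W\<close> carry cancelling labels they are folded together, which keeps \<open>W\<close> quadratic and is
  surjective on fundamental groups. In the end the label of \<open>W\<close> is literally
  \<open>a\<^sub>1\<^bsup>2n\<^sub>1\<^esup> \<dots> a\<^sub>g\<^bsup>2n\<^sub>g\<^esup>\<close>. The interlacing form of \<open>W\<close>, read off from its second order Magnus coefficients
  modulo 2, is then block diagonal with \<open>g\<close> nonzero blocks; but it is a sum of \<open>g\<close> forms of rank one.
  So every block has rank one, which forces \<open>W = u\<^sub>1\<^sup>2 \<dots> u\<^sub>g\<^sup>2\<close> with \<open>u\<^sub>i\<close> labelled
  \<open>a\<^sub>i\<^bsup>n\<^sub>i\<^esup>\<close>, and makes the folded graph a bouquet of the circles \<open>u\<^sub>i\<close>. Expressing the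
  original circles in the \<open>u\<^sub>i\<close> defines a surjective endomorphism of \<open>F\<close> fixing the product of squares; it
  is an automorphism since \<open>F\<close> is Hopfian.\<close>

section \<open>Words\<close>

text \<open>The obstacle is a cancelling pair of labels carried by a single edge, traversed back and
  forth: it offers no two edges to fold. It never arises. Cancelling the pair leaves a word freely
  equal to \<open>W\<close> without that edge, so the parities with which the paths
  \<open>P k\<close> cross the edge form a vector orthogonal to the corresponding vectors of all
  letters. As the target is no product of fewer than \<open>g\<close> squares, this vector vanishes
  and the edge is a bridge; its far end would be a leaf, which the use of reduced words rules out
  from the start. Working modulo 2 removes the linear coefficients of quadratic words and of
  squares, so that second order coefficients add up over blocks and over squares without cross
  terms. The blocks are nonzero because both occurrences of a letter carry the same exponent.
  Folding two edges that share both ends kills a loop, so injectivity on fundamental groups is lost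
  and only surjectivity can be carried along. This is why the Hopf property is needed at the
  end.\<close>

type_synonym 'z word = "('z \<times> bool) list"

definition letters :: "'z word \<Rightarrow> 'z set" where
  "letters w = fst ` set w"

lemma letters_simps [simp]:
  "letters [] = {}" "letters (l # w) = insert (fst l) (letters w)"
  "letters (u @ v) = letters u \<union> letters v"
  by (auto simp: letters_def)

lemma letters_concat [simp]: "letters (concat ws) = (\<Union>w\<in>set ws. letters w)"
  by (induction ws) auto

lemma finite_letters [simp]: "finite (letters w)"
  by (simp add: letters_def)

definition winv :: "'z word \<Rightarrow> 'z word" where
  "winv w = rev (map (\<lambda>(z, s). (z, \<not> s)) w)"

lemma winv_simps [simp]:
  "winv [] = []" "winv (l # w) = winv w @ [(fst l, \<not> snd l)]" "winv (u @ v) = winv v @ winv u"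
  by (auto simp: winv_def split: prod.splits)

lemma winv_winv [simp]: "winv (winv w) = w"
  by (induction w) auto

lemma letters_winv [simp]: "letters (winv w) = letters w"
  by (induction w) auto

definition rename :: "('y \<Rightarrow> 'z) \<Rightarrow> 'y word \<Rightarrow> 'z word" where
  "rename f w = map (\<lambda>(z, s). (f z, s)) w"

lemma rename_simps [simp]:
  "rename f [] = []" "rename f (l # w) = (f (fst l), snd l) # rename f w"
  "rename f (u @ v) = rename f u @ rename f v"
  by (auto simp: rename_def split: prod.splits)

lemma rename_concat: "rename f (concat ws) = concat (map (rename f) ws)"
  by (induction ws) auto

lemma rename_winv [simp]: "rename f (winv w) = winv (rename f w)"
  by (induction w) auto

lemma letters_rename [simp]: "letters (rename f w) = f ` letters w"
  by (induction w) auto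

lemma length_rename [simp]: "length (rename f w) = length w"
  by (simp add: rename_def)

definition subst_word :: "('i \<Rightarrow> 'z word) \<Rightarrow> 'i word \<Rightarrow> 'z word" where
  "subst_word P J = concat (map (\<lambda>(i, s). if s then P i else winv (P i)) J)"

lemma subst_word_simps [simp]:
  "subst_word P [] = []"
  "subst_word P (l # J) = (if snd l then P (fst l) else winv (P (fst l))) @ subst_word P J"
  "subst_word P (J @ K) = subst_word P J @ subst_word P K"
  by (auto simp: subst_word_def split: prod.splits)

lemma subst_word_winv: "subst_word P (winv J) = winv (subst_word P J)"
  by (induction J) auto

lemma rename_subst_word: "rename f (subst_word P J) = subst_word (\<lambda>i. rename f (P i)) J"
  by (induction J) auto

definition reduced :: "'z word \<Rightarrow> bool" where
  "reduced w \<longleftrightarrow> successively (\<lambda>(b, s) (c, t). \<not> (b = c \<and> s \<noteq> t)) w"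

lemma reduced_words_iff: "w \<in> reduced_words B \<longleftrightarrow> letters w \<subseteq> B \<and> reduced w"
  by (simp add: reduced_words_def letters_def reduced_def)

lemma not_successively_split:
  "\<not> successively R w \<Longrightarrow> \<exists>u a b v. w = u @ a # b # v \<and> \<not> R a b"
proof (induction w rule: induct_list012)
  case (3 x y zs)
  show ?case
  proof (cases "R x y")
    case True
    then have "\<not> successively R (y # zs)" using 3(3) by simp
    then obtain u a b v where "y # zs = u @ a # b # v" "\<not> R a b" using 3(2) by blast
    then have "x # y # zs = (x # u) @ a # b # v" "\<not> R a b" by auto
    then show ?thesis by blast
  next
    case False
    then have "x # y # zs = [] @ x # y # zs \<and> \<not> R x y" by simp
    then show ?thesis by blast
  qed
qed auto

lemma successively_nth_iff:
  "successively R w \<longleftrightarrow> (\<forall>i. Suc i < length w \<longrightarrow> R (w ! i) (w ! Suc i))"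
proof (induction w rule: induct_list012)
  case (3 x y zs)
  show ?case
    unfolding successively.simps 3(2)
    by (auto simp: nth_Cons split: nat.splits)
qed auto

section \<open>Free equivalence\<close>

text \<open>Equality in the free group on all letters, kept as a relation on words because edge
  paths, renamings and letter counts live on words.\<close>

inductive feq :: "'z word \<Rightarrow> 'z word \<Rightarrow> bool" (infix \<open>\<sim>\<close> 50) where
  feq_refl [simp]: "w \<sim> w"
| feq_sym: "u \<sim> v \<Longrightarrow> v \<sim> u"
| feq_trans [trans]: "u \<sim> v \<Longrightarrow> v \<sim> w \<Longrightarrow> u \<sim> w"
| feq_cancel: "u @ (z, s) # (z, \<not> s) # v \<sim> u @ v"

lemma feq_context: "u \<sim> v \<Longrightarrow> p @ u @ q \<sim> p @ v @ q"
proof (induction rule: feq.induct)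
  case (feq_cancel u z s v)
  show ?case using feq.feq_cancel[of "p @ u" z s "v @ q"] by simp
qed (auto intro: feq_sym feq_trans)

lemma feq_append: "u \<sim> u' \<Longrightarrow> v \<sim> v' \<Longrightarrow> u @ v \<sim> u' @ v'"
  using feq_context[of u u' "[]" v] feq_context[of v v' u' "[]"] by (auto intro: feq_trans)

lemma feq_rename: "u \<sim> v \<Longrightarrow> rename f u \<sim> rename f v"
proof (induction rule: feq.induct)
  case (feq_cancel u z s v)
  show ?case using feq.feq_cancel[of "rename f u" "f z" s "rename f v"] by simp
qed (auto intro: feq_sym feq_trans)

lemma feq_winv: "u \<sim> v \<Longrightarrow> winv u \<sim> winv v"
proof (induction rule: feq.induct)
  case (feq_cancel u z s v)
  show ?case using feq.feq_cancel[of "winv v" z s "winv u"] by simp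
qed (auto intro: feq_sym feq_trans)

lemma feq_append_winv: "w @ winv w \<sim> []"
proof (induction w)
  case (Cons l w)
  have "[l] @ (w @ winv w) @ [(fst l, \<not> snd l)] \<sim> [l] @ [] @ [(fst l, \<not> snd l)]"
    by (rule feq_context) (rule Cons)
  also have "\<dots> \<sim> []" using feq_cancel[of "[]" "fst l" "snd l" "[]"] by simp
  finally show ?case by simp
qed simp

lemma feq_winv_append: "winv w @ w \<sim> []"
  using feq_append_winv[of "winv w"] by simp

lemma feq_move_winv: "u @ v \<sim> w \<Longrightarrow> w @ winv v \<sim> u"
  using feq_append[of w "u @ v" "winv v" "winv v"] feq_append[of u u "v @ winv v" "[]"]
    feq_append_winv[of v] by (auto intro: feq_sym feq_trans)

lemma feq_reduced_exists: "\<exists>r. w \<sim> r \<and> reduced r \<and> letters r \<subseteq> letters w"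
proof (induction w rule: length_induct)
  case (1 w)
  show ?case
  proof (cases "reduced w")
    case False
    then obtain u a b v where "w = u @ a # b # v" "\<not> (case a of (b, s) \<Rightarrow> \<lambda>(c, t). \<not> (b = c \<and> s \<noteq> t)) b"
      unfolding reduced_def using not_successively_split by blast
    then have w: "w = u @ a # b # v" "fst a = fst b" "snd a \<noteq> snd b" by (auto split: prod.splits)
    then have b: "b = (fst a, \<not> snd a)" by (cases b) auto
    have "w \<sim> u @ v" using feq_cancel[of u "fst a" "snd a" v] by (simp add: w(1) b)
    moreover obtain r where "u @ v \<sim> r" "reduced r" "letters r \<subseteq> letters (u @ v)"
      using 1[rule_format, of "u @ v"] w(1) by auto
    ultimately show ?thesis using w(1) feq_trans[of w "u @ v" r] by auto
  qed (blast intro: feq_refl)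
qed

section \<open>Values in a group\<close>

definition val :: "('g, 'm) monoid_scheme \<Rightarrow> ('z \<Rightarrow> 'g) \<Rightarrow> 'z word \<Rightarrow> 'g" where
  "val G f w = foldr (\<lambda>(b, s) r. (if s then f b else inv\<^bsub>G\<^esub> (f b)) \<otimes>\<^bsub>G\<^esub> r) w \<one>\<^bsub>G\<^esub>"

lemma val_simps [simp]:
  "val G f [] = \<one>\<^bsub>G\<^esub>"
  "val G f (l # w) = (if snd l then f (fst l) else inv\<^bsub>G\<^esub> (f (fst l))) \<otimes>\<^bsub>G\<^esub> val G f w"
  by (auto simp: val_def split: prod.splits)

lemma word_value_eq_val: "word_value G w = val G (\<lambda>b. b) w"
  by (simp add: word_value_def val_def)

lemma val_rename: "val G f (rename h w) = val G (\<lambda>z. f (h z)) w"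
  by (induction w) auto

lemma val_cong: "(\<And>z. z \<in> letters w \<Longrightarrow> f z = h z) \<Longrightarrow> val G f w = val G h w"
  by (induction w) auto

context group
begin

lemma val_closed [simp]: "f ` letters w \<subseteq> carrier G \<Longrightarrow> val G f w \<in> carrier G"
  by (induction w) auto

lemma val_append:
  "f ` letters u \<subseteq> carrier G \<Longrightarrow> f ` letters v \<subseteq> carrier G \<Longrightarrow>
    val G f (u @ v) = val G f u \<otimes> val G f v"
  by (induction u) (auto simp: m_assoc)

lemma val_winv: "f ` letters w \<subseteq> carrier G \<Longrightarrow> val G f (winv w) = inv (val G f w)"
  by (induction w) (auto simp: val_append inv_mult_group)

lemma val_feq: "u \<sim> v \<Longrightarrow> range f \<subseteq> carrier G \<Longrightarrow> val G f u = val G f v"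
proof (induction rule: feq.induct)
  case (feq_cancel u z s v)
  have f: "f z \<in> carrier G" for z using feq_cancel by auto
  have c: "f ` letters w \<subseteq> carrier G" for w using f by auto
  have "val G f ((z, s) # (z, \<not> s) # v) = val G f v"
    using f[of z] c[of v] by (cases s) (simp_all flip: m_assoc)
  then show ?case by (simp only: val_append[OF c c])
qed auto

lemma val_subst_word:
  assumes "\<And>i. f ` letters (P i) \<subseteq> carrier G"
  shows "val G f (subst_word P J) = val G (\<lambda>i. val G f (P i)) J"
proof (induction J)
  case (Cons l J)
  have "f ` letters (subst_word P J) \<subseteq> carrier G"
    using assms by (induction J) (auto simp: image_Un)
  with Cons show ?case using assms by (simp add: val_append val_winv)
qed simp

end

lemma hom_val:
  assumes "group G" "group K" "\<psi> \<in> hom G K" "f ` letters w \<subseteq> carrier G"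
  shows "\<psi> (val G f w) = val K (\<lambda>z. \<psi> (f z)) w"
proof -
  interpret group_hom G K \<psi> using assms by (simp add: group_hom_def group_hom_axioms_def)
  show ?thesis using assms(4) by (induction w) auto
qed

section \<open>Free groups\<close>

lemma free_basis_imp_group: assumes "free_basis F S" shows "group F"
  using assms by (simp add: free_basis_def)

lemma free_basis_subset: "free_basis F S \<Longrightarrow> S \<subseteq> carrier F"
  by (simp add: free_basis_def)

lemma free_basis_word_exists:
  assumes "free_basis F S" "y \<in> carrier F"
  obtains w where "w \<in> reduced_words S" "word_value F w = y"
proof -
  have "y \<in> word_value F ` reduced_words S"
    using assms by (simp add: free_basis_def bij_betw_def)
  then show ?thesis using that by blast
qed

text \<open>Both words cancel down to reduced words over \<open>S\<close> with the same value, and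
  those coincide.\<close>

lemma free_basis_eq_imp_feq:
  assumes F: "free_basis F S" and "letters u \<subseteq> S" "letters v \<subseteq> S" "word_value F u = word_value F v"
  shows "u \<sim> v"
proof -
  interpret group F using F by (rule free_basis_imp_group)
  have S: "S \<subseteq> carrier F" using F by (rule free_basis_subset)
  obtain r where r: "u \<sim> r" "r \<in> reduced_words S"
    using feq_reduced_exists[of u] assms(2) by (auto simp: reduced_words_iff)
  obtain s where s: "v \<sim> s" "s \<in> reduced_words S"
    using feq_reduced_exists[of v] assms(3) by (auto simp: reduced_words_iff)
  \<comment> \<open>\<open>val_feq\<close> wants a value in the carrier for every letter, hence the
    default off the basis.\<close>
  define j where "j = (\<lambda>b. if b \<in> S then b else \<one>\<^bsub>F\<^esub>)"
  have j: "range j \<subseteq> carrier F" using S by (auto simp: j_def)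
  have val_j: "word_value F w = val F j w" if "letters w \<subseteq> S" for w
    unfolding word_value_eq_val using that by (intro val_cong) (auto simp: j_def)
  have "word_value F r = word_value F s"
    using assms(2-4) r s val_feq[OF r(1) j] val_feq[OF s(1) j]
    by (simp add: val_j reduced_words_iff)
  then have "r = s"
    using F r(2) s(2) unfolding free_basis_def bij_betw_def by (blast dest: inj_onD)
  then show ?thesis using r(1) s(1) by (blast intro: feq_trans feq_sym)
qed

text \<open>Universal property. The choice of a word for each element is harmless: words with equal
  value are freely equivalent, hence have equal value in \<open>K\<close>.\<close>

lemma free_basis_extend:
  assumes F: "free_basis F S" and K: "group K" and f: "\<And>b. b \<in> S \<Longrightarrow> f b \<in> carrier K"
  obtains \<psi> where "\<psi> \<in> hom F K" "\<And>b. b \<in> S \<Longrightarrow> \<psi> b = f b"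
proof -
  interpret F: group F using F by (rule free_basis_imp_group)
  interpret K: group K by (rule K)
  have S: "S \<subseteq> carrier F" using F by (rule free_basis_subset)
  define f' where "f' = (\<lambda>b. if b \<in> S then f b else \<one>\<^bsub>K\<^esub>)"
  have f': "range f' \<subseteq> carrier K" using f by (auto simp: f'_def)
  have f'c: "f' ` A \<subseteq> carrier K" for A using f' by blast
  define wd where "wd = (\<lambda>y. SOME w. letters w \<subseteq> S \<and> word_value F w = y)"
  have wd: "letters (wd y) \<subseteq> S \<and> word_value F (wd y) = y" if y: "y \<in> carrier F" for y
  proof -
    obtain w where "w \<in> reduced_words S" "word_value F w = y"
      using free_basis_word_exists[OF F y] .
    then have "\<exists>w. letters w \<subseteq> S \<and> word_value F w = y"
      unfolding reduced_words_iff by blast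
    then show ?thesis unfolding wd_def by (rule someI_ex)
  qed
  define \<psi> where "\<psi> = (\<lambda>y. val K f' (wd y))"
  have eq: "\<psi> (word_value F w) = val K f' w" if w: "letters w \<subseteq> S" for w
  proof -
    have "word_value F w \<in> carrier F" using w S by (auto simp: word_value_eq_val)
    then have "wd (word_value F w) \<sim> w" using free_basis_eq_imp_feq[OF F _ w] wd by blast
    then show ?thesis unfolding \<psi>_def using f' by (rule K.val_feq)
  qed
  have "\<psi> \<in> hom F K"
  proof (rule homI)
    fix a b assume ab: "a \<in> carrier F" "b \<in> carrier F"
    show "\<psi> a \<in> carrier K" unfolding \<psi>_def using f'c by simp
    have "(\<lambda>b. b) ` letters (wd a) \<subseteq> carrier F" "(\<lambda>b. b) ` letters (wd b) \<subseteq> carrier F"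
      using ab wd S by auto
    then have "word_value F (wd a @ wd b) = word_value F (wd a) \<otimes>\<^bsub>F\<^esub> word_value F (wd b)"
      unfolding word_value_eq_val by (rule F.val_append)
    then have "a \<otimes>\<^bsub>F\<^esub> b = word_value F (wd a @ wd b)" using ab wd by simp
    then have "\<psi> (a \<otimes>\<^bsub>F\<^esub> b) = val K f' (wd a @ wd b)"
      using eq[of "wd a @ wd b"] ab wd by simp
    then show "\<psi> (a \<otimes>\<^bsub>F\<^esub> b) = \<psi> a \<otimes>\<^bsub>K\<^esub> \<psi> b"
      unfolding \<psi>_def using f'c by (simp add: K.val_append)
  qed
  moreover have "\<psi> b = f b" if b: "b \<in> S" for b
    using eq[of "[(b, True)]"] b S f by (auto simp: word_value_eq_val f'_def)
  ultimately show ?thesis by (rule that)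
qed

lemma free_basis_hom_eq:
  assumes F: "free_basis F S" and K: "group K" and "\<psi> \<in> hom F K" "\<psi>' \<in> hom F K"
    and "\<And>b. b \<in> S \<Longrightarrow> \<psi> b = \<psi>' b" and y: "y \<in> carrier F"
  shows "\<psi> y = \<psi>' y"
proof -
  have S: "S \<subseteq> carrier F" and "group F" using F by (simp_all add: free_basis_def)
  obtain w where w: "w \<in> reduced_words S" "word_value F w = y"
    using free_basis_word_exists[OF F y] .
  have lw: "letters w \<subseteq> S" using w by (simp add: reduced_words_iff)
  have "\<psi> (val F (\<lambda>b. b) w) = \<psi>' (val F (\<lambda>b. b) w)"
    using lw S assms(5) by (auto simp: hom_val[OF \<open>group F\<close> K] assms(3,4) intro!: val_cong)
  then show ?thesis using w by (simp add: word_value_eq_val)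
qed

section \<open>Finitely generated free groups are Hopfian\<close>

text \<open>Completes the partial injections by which letters act to permutations.\<close>

lemma extend_inj_to_bij:
  assumes "finite S" "A \<subseteq> S" "f ` A \<subseteq> S" "inj_on f A"
  obtains h where "bij_betw h S S" "\<And>a. a \<in> A \<Longrightarrow> h a = f a"
proof -
  have "card (S - A) = card (S - f ` A)"
    using assms by (simp add: card_Diff_subset card_image finite_subset)
  then obtain h where h: "bij_betw h (S - A) (S - f ` A)"
    using finite_same_card_bij[of "S - A" "S - f ` A"] assms(1) by auto
  define k where "k = (\<lambda>a. if a \<in> A then f a else h a)"
  have "bij_betw k A (f ` A)"
    using assms(4) by (auto simp: k_def bij_betw_def inj_on_def)
  moreover have "bij_betw k (S - A) (S - f ` A)"
    using h by (subst bij_betw_cong[where g = h]) (auto simp: k_def)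
  ultimately have "bij_betw k (A \<union> (S - A)) (f ` A \<union> (S - f ` A))"
    by (rule bij_betw_combine) auto
  moreover have "A \<union> (S - A) = S" "f ` A \<union> (S - f ` A) = S" using assms by auto
  ultimately show ?thesis using that[of k] by (simp add: k_def)
qed

text \<open>The letters of \<open>w\<close> are made to act so that \<open>w\<close> moves the point \<open>length w\<close> down to \<open>0\<close>,
  one step per letter.\<close>

lemma reduced_word_acts_nontrivially:
  assumes red: "reduced (w :: 'z word)" and "w \<noteq> []"
  obtains f :: "'z \<Rightarrow> nat \<Rightarrow> nat" where "\<And>z. f z \<in> Bij {..length w}"
    "val (BijGroup {..length w}) f w \<noteq> \<one>\<^bsub>BijGroup {..length w}\<^esub>"
proof -
  define L where "L = length w"
  define A where "A = (\<lambda>z. {Suc j | j. j < L \<and> w ! j = (z, True)} \<union> {j. j < L \<and> w ! j = (z, False)})"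
  define p where "p = (\<lambda>z m. if \<exists>j<L. m = Suc j \<and> w ! j = (z, True) then m - 1 else Suc m)"
  \<comment> \<open>Reducedness makes the prescription consistent: one half keeps \<open>p z\<close>
    from receiving two values at a point, the other makes it injective.\<close>
  have adj: "\<not> (w ! j = (z, s) \<and> w ! Suc j = (z, \<not> s))" if "Suc j < L" for j z s
    using red that unfolding reduced_def successively_nth_iff L_def by fastforce
  have pT: "p z (Suc j) = j" if "j < L" "w ! j = (z, True)" for z j
    using that by (auto simp: p_def)
  have pF: "p z j = Suc j" if "j < L" "w ! j = (z, False)" for z j
    using that adj[of _ z True] by (auto simp: p_def)
  have "\<exists>h. h \<in> Bij {..L} \<and> (\<forall>a\<in>A z. h a = p z a)" for z
  proof -
    have "A z \<subseteq> {..L}" by (auto simp: A_def)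
    moreover have "p z ` A z \<subseteq> {..L}" by (auto simp: A_def pT pF)
    moreover have "inj_on (p z) (A z)"
    proof (rule inj_onI)
      fix m n assume "m \<in> A z" "n \<in> A z" "p z m = p z n"
      then show "m = n"
        using adj[of _ z False] by (auto simp: A_def pT pF)
    qed
    ultimately obtain h where h: "bij_betw h {..L} {..L}" "\<And>a. a \<in> A z \<Longrightarrow> h a = p z a"
      using extend_inj_to_bij[of "{..L}" "A z" "p z"] by auto
    have "restrict h {..L} \<in> Bij {..L}"
      using h(1) by (simp add: Bij_def)
    moreover have "\<forall>a\<in>A z. restrict h {..L} a = p z a"
      using h(2) \<open>A z \<subseteq> {..L}\<close> by auto
    ultimately show ?thesis by blast
  qed
  then obtain f where f: "\<And>z. f z \<in> Bij {..L}" "\<And>z a. a \<in> A z \<Longrightarrow> f z a = p z a" by metis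
  interpret group "BijGroup {..L}" by (rule group_BijGroup)
  have carr: "carrier (BijGroup {..L}) = Bij {..L}" by (simp add: BijGroup_def)
  have cl: "f ` B \<subseteq> carrier (BijGroup {..L})" for B using f(1) by (auto simp: carr)
  \<comment> \<open>The product is composition, so the last letter acts first; hence the induction
    runs over suffixes.\<close>
  have "val (BijGroup {..L}) f (drop (L - i) w) L = L - i" if "i \<le> L" for i
    using that
  proof (induction i)
    case 0
    then show ?case by (simp add: L_def BijGroup_def)
  next
    case (Suc i)
    define j where "j = L - Suc i"
    have j: "j < L" "Suc j = L - i" using Suc by (auto simp: j_def)
    obtain z s where zs: "w ! j = (z, s)" by fastforce
    have drop: "drop j w = (z, s) # drop (L - i) w"
      using j zs by (simp add: L_def flip: Cons_nth_drop_Suc)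
    define v where "v = val (BijGroup {..L}) f (drop (L - i) w)"
    have v: "v \<in> Bij {..L}" "v L = Suc j"
      using Suc val_closed[OF cl, of "drop (L - i) w"] j by (simp_all add: v_def carr)
    define e where "e = (if s then f z else inv\<^bsub>BijGroup {..L}\<^esub> (f z))"
    have e_Suc: "e (Suc j) = j"
    proof (cases s)
      case True
      then have "Suc j \<in> A z" using j zs by (auto simp: A_def)
      then show ?thesis using f(2)[of "Suc j" z] pT[of j z] j(1) zs True by (simp add: e_def)
    next
      case False
      then have "j \<in> A z" using j zs by (auto simp: A_def)
      then have "f z j = Suc j" using f(2) pF j zs False by simp
      moreover have "inj_on (f z) {..L}" using f(1)[of z] by (simp add: Bij_def bij_betw_def)
      ultimately show ?thesis
        using False f(1) j(1) inv_into_f_f[of "f z" "{..L}" j] by (auto simp: e_def inv_BijGroup)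
    qed
    have "e \<in> Bij {..L}"
      using f(1) inv_closed[of "f z"] by (simp add: e_def carr)
    have "val (BijGroup {..L}) f (drop j w) = e \<otimes>\<^bsub>BijGroup {..L}\<^esub> v"
      by (simp add: drop v_def e_def)
    also have "\<dots> = compose {..L} e v"
      using \<open>e \<in> Bij {..L}\<close> v(1) by (simp add: BijGroup_def)
    finally have "val (BijGroup {..L}) f (drop j w) L = j"
      using v(2) e_Suc by (simp add: compose_def)
    then show ?case by (simp add: j_def)
  qed
  from this[of L] have "val (BijGroup {..L}) f w L = 0" by simp
  moreover have "\<one>\<^bsub>BijGroup {..L}\<^esub> L = L" by (simp add: BijGroup_def)
  moreover have "L \<noteq> 0" using \<open>w \<noteq> []\<close> by (simp add: L_def)
  ultimately have "val (BijGroup {..L}) f w \<noteq> \<one>\<^bsub>BijGroup {..L}\<^esub>" by auto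
  then show ?thesis using that f(1) unfolding L_def by blast
qed

lemma finite_Bij: "finite A \<Longrightarrow> finite (Bij A)"
  by (rule finite_subset[OF _ finite_PiE[of A "\<lambda>_. A"]]) (auto simp: Bij_def bij_betw_def extensional_def)

text \<open>Restriction along a surjective endomorphism \<open>\<psi>\<close> is an injective, hence surjective, self-map of
  the finite set of homomorphisms to a fixed finite group, so every such homomorphism kills the
  kernel of \<open>\<psi>\<close>.\<close>

theorem free_basis_hopfian:
  assumes F: "free_basis F S" and "finite S" and \<psi>: "\<psi> \<in> hom F F" "\<psi> ` carrier F = carrier F"
  shows "inj_on \<psi> (carrier F)"
proof -
  interpret F: group F using F by (rule free_basis_imp_group)
  interpret \<psi>: group_hom F F \<psi> using \<psi>(1) by unfold_locales
  have S: "S \<subseteq> carrier F" using F by (rule free_basis_subset)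
  have "k = \<one>\<^bsub>F\<^esub>" if k: "k \<in> carrier F" "\<psi> k = \<one>\<^bsub>F\<^esub>" for k
  proof (rule ccontr)
    assume "k \<noteq> \<one>\<^bsub>F\<^esub>"
    obtain w where w: "w \<in> reduced_words S" "word_value F w = k"
      using free_basis_word_exists[OF F k(1)] .
    then have "w \<noteq> []" "reduced w" "letters w \<subseteq> S"
      using \<open>k \<noteq> \<one>\<^bsub>F\<^esub>\<close> by (auto simp: word_value_eq_val reduced_words_iff)
    then obtain f :: "'a \<Rightarrow> nat \<Rightarrow> nat" where f: "\<And>z. f z \<in> Bij {..length w}"
      "val (BijGroup {..length w}) f w \<noteq> \<one>\<^bsub>BijGroup {..length w}\<^esub>"
      using reduced_word_acts_nontrivially by blast
    define K where "K = BijGroup {..length w}"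
    have "group K" by (simp add: K_def group_BijGroup)
    interpret K: group K by fact
    have fK: "f z \<in> carrier K" for z using f(1) by (simp add: K_def BijGroup_def)
    have "finite (carrier K)" by (simp add: K_def BijGroup_def finite_Bij)
    \<comment> \<open>A homomorphism into \<open>K\<close> is determined by its values on
      \<open>S\<close>, so this finite set parametrizes all of them.\<close>
    define \<Theta> where "\<Theta> = (S \<rightarrow>\<^sub>E carrier K)"
    have "finite \<Theta>" using \<open>finite S\<close> \<open>finite (carrier K)\<close> by (simp add: \<Theta>_def finite_PiE)
    have "\<exists>\<chi>. \<chi> \<in> hom F K \<and> (\<forall>b\<in>S. \<chi> b = \<theta> b)" if "\<theta> \<in> \<Theta>" for \<theta>
    proof -
      have "\<theta> b \<in> carrier K" if "b \<in> S" for b using \<open>\<theta> \<in> \<Theta>\<close> that by (auto simp: \<Theta>_def)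
      then obtain \<chi> where "\<chi> \<in> hom F K" "\<And>b. b \<in> S \<Longrightarrow> \<chi> b = \<theta> b"
        using free_basis_extend[OF F \<open>group K\<close>, where f = \<theta>] by metis
      then show ?thesis by blast
    qed
    then obtain ext where ext: "\<And>\<theta>. \<theta> \<in> \<Theta> \<Longrightarrow> ext \<theta> \<in> hom F K"
      "\<And>\<theta> b. \<theta> \<in> \<Theta> \<Longrightarrow> b \<in> S \<Longrightarrow> ext \<theta> b = \<theta> b" by metis
    have comp: "(\<lambda>y. ext \<theta> (\<psi> y)) \<in> hom F K" if "\<theta> \<in> \<Theta>" for \<theta>
      using hom_compose[OF \<psi>(1) ext(1)[OF that]] by (simp add: o_def)
    define \<Phi> where "\<Phi> = (\<lambda>\<theta>. \<lambda>b\<in>S. ext \<theta> (\<psi> b))"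
    have "\<Phi> ` \<Theta> \<subseteq> \<Theta>"
    proof (rule image_subsetI)
      fix \<theta> assume \<theta>: "\<theta> \<in> \<Theta>"
      have "ext \<theta> (\<psi> b) \<in> carrier K" if "b \<in> S" for b
        using hom_in_carrier[OF comp[OF \<theta>]] that S by blast
      then show "\<Phi> \<theta> \<in> \<Theta>" by (auto simp: \<Phi>_def \<Theta>_def)
    qed
    moreover have "inj_on \<Phi> \<Theta>"
    proof (rule inj_onI)
      fix \<theta> \<theta>' assume \<theta>: "\<theta> \<in> \<Theta>" "\<theta>' \<in> \<Theta>" "\<Phi> \<theta> = \<Phi> \<theta>'"
      have "ext \<theta> (\<psi> b) = ext \<theta>' (\<psi> b)" if "b \<in> S" for b
        using fun_cong[OF \<theta>(3), of b] that by (simp add: \<Phi>_def)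
      then have "ext \<theta> (\<psi> y) = ext \<theta>' (\<psi> y)" if "y \<in> carrier F" for y
        using free_basis_hom_eq[OF F \<open>group K\<close> comp[OF \<theta>(1)] comp[OF \<theta>(2)]] that by blast
      \<comment> \<open>Every element is of the form \<open>\<psi> y\<close>, so agreement after
        \<open>\<psi>\<close> is agreement.\<close>
      then have "ext \<theta> y = ext \<theta>' y" if "y \<in> carrier F" for y
        using that \<psi>(2) by (force simp: image_iff)
      then have "\<theta> b = \<theta>' b" if "b \<in> S" for b
        using that S ext(2)[OF \<theta>(1)] ext(2)[OF \<theta>(2)] by (metis subsetD)
      then show "\<theta> = \<theta>'" using \<theta>(1,2) unfolding \<Theta>_def by (auto intro: PiE_ext)
    qed
    ultimately have "\<Phi> ` \<Theta> = \<Theta>" using \<open>finite \<Theta>\<close> by (simp add: endo_inj_surj)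
    \<comment> \<open>The action that detects \<open>k\<close> also factors through
      \<open>\<psi>\<close>, and therefore kills \<open>k\<close>.\<close>
    moreover have f\<Theta>: "restrict f S \<in> \<Theta>" using fK by (auto simp: \<Theta>_def)
    ultimately obtain \<theta> where \<theta>: "\<theta> \<in> \<Theta>" "restrict f S = \<Phi> \<theta>" by blast
    have "ext (restrict f S) b = ext \<theta> (\<psi> b)" if "b \<in> S" for b
      using ext(2)[OF f\<Theta> that] fun_cong[OF \<theta>(2), of b] that by (simp add: \<Phi>_def)
    then have "ext (restrict f S) k = ext \<theta> (\<psi> k)"
      using free_basis_hom_eq[OF F \<open>group K\<close> ext(1)[OF f\<Theta>] comp[OF \<theta>(1)]] k(1) by blast
    also have "\<dots> = \<one>\<^bsub>K\<^esub>"
      using k hom_one[OF ext(1)[OF \<theta>(1)] F.is_group \<open>group K\<close>] by simp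
    finally have "ext (restrict f S) (val F (\<lambda>b. b) w) = \<one>\<^bsub>K\<^esub>"
      using w by (simp add: word_value_eq_val)
    moreover have "ext (restrict f S) (val F (\<lambda>b. b) w) = val K f w"
      using \<open>letters w \<subseteq> S\<close> S ext(2)[OF f\<Theta>]
      by (subst hom_val[OF F.is_group \<open>group K\<close> ext(1)[OF f\<Theta>]]) (auto intro!: val_cong)
    ultimately show False using f(2) by (simp add: K_def)
  qed
  then show ?thesis by (simp add: \<psi>.inj_on_one_iff)
qed

section \<open>Second order Magnus coefficients modulo 2\<close>

fun cnt :: "'z \<Rightarrow> 'z word \<Rightarrow> bit" where
  "cnt z [] = 0"
| "cnt z (l # w) = of_bool (fst l = z) + cnt z w"

text \<open>\<open>mag z y w\<close> is the coefficient of \<open>Z Y\<close> in the image of \<open>w\<close> under the Magnus embedding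
  \<open>z \<mapsto> 1 + Z\<close>, reduced modulo 2; the last summand is the \<open>Z\<^sup>2\<close> term of
  \<open>(1 + Z)\<^sup>-\<^sup>1\<close>. If every letter occurs twice in \<open>w\<close>, then \<open>mag z y w\<close> for \<open>z \<noteq> y\<close> tells whether the
  occurrences of \<open>z\<close> and \<open>y\<close> interlace, and \<open>mag z z w\<close> whether the two exponents of \<open>z\<close> agree.\<close>

fun mag :: "'z \<Rightarrow> 'z \<Rightarrow> 'z word \<Rightarrow> bit" where
  "mag z y [] = 0"
| "mag z y (l # w) =
     mag z y w + of_bool (fst l = z) * cnt y w + of_bool (fst l = z \<and> z = y \<and> \<not> snd l)"

lemma bit_self_add [simp]: "b + b = (0 :: bit)" "b + (b + c) = (c :: bit)"
  by (cases b; cases c; simp)+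

lemma cnt_append [simp]: "cnt z (u @ v) = cnt z u + cnt z v"
  by (induction u) (auto simp: add.assoc)

lemma cnt_winv [simp]: "cnt z (winv w) = cnt z w"
  by (induction w) (auto simp: add.commute)

lemma cnt_notin: "z \<notin> letters w \<Longrightarrow> cnt z w = 0"
  by (induction w) auto

lemma cnt_feq: "u \<sim> v \<Longrightarrow> cnt z u = cnt z v"
  by (induction rule: feq.induct) (auto simp: add.assoc)

text \<open>The degree two part of a product of two series with constant term one.\<close>

lemma mag_append: "mag z y (u @ v) = mag z y u + mag z y v + cnt z u * cnt y v"
proof (induction u)
  case (Cons l u)
  have A: "a + b + c * d + o1 * (e + d) + o2 = a + o1 * e + o2 + b + (o1 + c) * d"
    for a b c d e o1 o2 :: bit
    by (simp only: ac_simps distrib_left distrib_right)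
  show ?case by (simp only: append_Cons mag.simps cnt.simps Cons cnt_append A)
qed simp

lemma mag_notin: "z \<notin> letters w \<or> y \<notin> letters w \<Longrightarrow> mag z y w = 0"
  by (induction w) (auto simp: cnt_notin)

lemma mag_feq: "u \<sim> v \<Longrightarrow> mag z y u = mag z y v"
proof (induction rule: feq.induct)
  case (feq_cancel u x s v)
  have "mag z y ((x, s) # (x, \<not> s) # v) = mag z y v"
    by (cases s; cases "x = z"; cases "x = y") (auto simp: add.assoc)
  then show ?case by (auto simp: mag_append add.assoc)
qed auto

lemma cnt_rename_upd:
  "z \<noteq> y \<Longrightarrow> cnt x (rename (id(y := z)) w) =
    (if x = z then cnt z w + cnt y w else if x = y then 0 else cnt x w)"
proof (induction w)
  case (Cons l w)
  then show ?case by (cases "fst l = y"; cases "fst l = z"; cases "x = z") (auto simp: add.assoc add.left_commute)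
qed simp

definition sqprod :: "(nat \<Rightarrow> 'z word) \<Rightarrow> nat \<Rightarrow> 'z word" where
  "sqprod P g = concat (map (\<lambda>i. P i @ P i) [1..<Suc g])"

lemma sqprod_Suc: "sqprod P (Suc g) = sqprod P g @ P (Suc g) @ P (Suc g)"
  by (simp add: sqprod_def)

lemma letters_sqprod: "letters (sqprod P g) = (\<Union>i\<in>{1..g}. letters (P i))"
  by (simp add: sqprod_def atLeastLessThanSuc_atLeastAtMost del: upt_Suc)

lemma rename_sqprod: "rename f (sqprod P g) = sqprod (\<lambda>i. rename f (P i)) g"
  by (simp add: sqprod_def rename_concat comp_def)

lemma cnt_sqprod: "cnt z (sqprod P g) = 0"
  by (induction g) (simp_all add: sqprod_def)

text \<open>A square has no linear term modulo 2, so there are no cross terms between factors;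
  within one square the second order coefficient of \<open>P i\<close> appears twice and cancels,
  leaving a rank one form.\<close>

lemma mag_sqprod: "mag z y (sqprod P g) = (\<Sum>i=1..g. cnt z (P i) * cnt y (P i))"
proof (induction g)
  case (Suc g)
  then show ?case by (simp add: sqprod_Suc mag_append cnt_sqprod)
qed (simp add: sqprod_def)

section \<open>Quadratic words\<close>

definition occ :: "'z \<Rightarrow> 'z word \<Rightarrow> nat" where
  "occ z w = length (filter (\<lambda>l. fst l = z) w)"

lemma occ_simps [simp]:
  "occ z [] = 0" "occ z (l # w) = (if fst l = z then Suc (occ z w) else occ z w)"
  "occ z (u @ v) = occ z u + occ z v"
  by (auto simp: occ_def)

lemma occ_eq_0_iff: "occ z w = 0 \<longleftrightarrow> z \<notin> letters w"
  by (induction w) auto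

lemma cnt_eq_occ: "cnt z w = of_nat (occ z w)"
  by (induction w) auto

lemma length_eq_sum_occ: "finite A \<Longrightarrow> letters w \<subseteq> A \<Longrightarrow> length w = (\<Sum>z\<in>A. occ z w)"
proof (induction w)
  case (Cons l w)
  have "(\<Sum>z\<in>A. occ z (l # w)) = (\<Sum>z\<in>A. of_bool (z = fst l) + occ z w)"
    by (intro sum.cong) auto
  also have "\<dots> = 1 + (\<Sum>z\<in>A. occ z w)"
    using Cons(2,3) by (simp add: sum.distrib of_bool_def)
  finally show ?case using Cons by simp
qed simp

lemma distinct_if_occ_1: "(\<And>z. z \<in> letters w \<Longrightarrow> occ z w = 1) \<Longrightarrow> distinct (map fst w)"
proof (induction w)
  case (Cons l w)
  have l: "fst l \<notin> letters w" using Cons(2)[of "fst l"] by (simp add: occ_eq_0_iff)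
  have "occ z w = 1" if "z \<in> letters w" for z
  proof -
    have "fst l \<noteq> z" using that l by auto
    then show ?thesis using Cons(2)[of z] that by simp
  qed
  then show ?case using Cons(1) l by (simp add: letters_def)
qed simp

definition quadratic :: "'z word \<Rightarrow> bool" where
  "quadratic w \<longleftrightarrow> (\<forall>z\<in>letters w. occ z w = 2)"

lemma quadratic_split:
  assumes "occ z w = 2"
  obtains u s v t x where "w = u @ (z, s) # v @ (z, t) # x"
    "z \<notin> letters u" "z \<notin> letters v" "z \<notin> letters x"
proof -
  have split: "\<exists>u s v. w = u @ (z, s) # v \<and> z \<notin> letters u" if "occ z w > 0" for w
    using that
  proof (induction w)
    case (Cons l w)
    show ?case
    proof (cases "fst l = z")
      case True
      then have "l # w = [] @ (z, snd l) # w \<and> z \<notin> letters []" by auto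
      then show ?thesis by blast
    next
      case False
      then obtain u s v where "w = u @ (z, s) # v" "z \<notin> letters u" using Cons by auto
      then have "l # w = (l # u) @ (z, s) # v \<and> z \<notin> letters (l # u)" using False by auto
      then show ?thesis by blast
    qed
  qed simp
  obtain u s v where 1: "w = u @ (z, s) # v" "z \<notin> letters u" using split[of w] assms by auto
  then have "occ z v = 1" using assms occ_eq_0_iff[of z u] by simp
  then obtain v' t x where 2: "v = v' @ (z, t) # x" "z \<notin> letters v'" using split[of v] by auto
  then have "z \<notin> letters x" using \<open>occ z v = 1\<close> occ_eq_0_iff[of z v'] occ_eq_0_iff[of z x] by simp
  with 1 2 that show ?thesis by simp
qed

text \<open>The pair of occurrences is counted once; if the exponents are negative, the two extra
  terms of the inverses cancel.\<close>

lemma mag_self: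
  assumes "occ z w = 2" and "\<And>l. l \<in> set w \<Longrightarrow> snd l = s"
  shows "mag z z w = 1"
proof -
  obtain u s1 v s2 x where w: "w = u @ (z, s1) # v @ (z, s2) # x"
    "z \<notin> letters u" "z \<notin> letters v" "z \<notin> letters x"
    using quadratic_split[OF assms(1)] .
  then have "s1 = s2" using assms(2)[of "(z, s1)"] assms(2)[of "(z, s2)"] by simp
  then show ?thesis using w by (simp add: mag_append mag_notin cnt_notin)
qed

text \<open>One occurrence each of \<open>z\<close> and \<open>y\<close> remains, and these become
  the two occurrences of \<open>z\<close>.\<close>

lemma quadratic_fold:
  assumes "quadratic (u @ (z, s) # (y, t) # v)" "z \<noteq> y"
  shows "quadratic (rename (id(y := z)) (u @ v))" "letters (u @ (z, s) # (y, t) # v) = letters (u @ v)"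
proof -
  let ?w = "u @ (z, s) # (y, t) # v"
  have o: "occ z (u @ v) = 1" "occ y (u @ v) = 1"
    using assms by (force simp: quadratic_def)+
  then have zy: "z \<in> letters (u @ v)" "y \<in> letters (u @ v)"
    by (metis occ_eq_0_iff zero_neq_one)+
  then show "letters ?w = letters (u @ v)" by auto
  have ren: "occ x (rename (id(y := z)) w) = (if x = z then occ z w + occ y w else if x = y then 0 else occ x w)"
    for x and w
    using \<open>z \<noteq> y\<close> by (induction w) auto
  show "quadratic (rename (id(y := z)) (u @ v))"
    unfolding quadratic_def
  proof
    fix x assume x: "x \<in> letters (rename (id(y := z)) (u @ v))"
    show "occ x (rename (id(y := z)) (u @ v)) = 2"
    proof (cases "x = z")
      case True
      then show ?thesis using o ren[of z "u @ v"] by simp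
    next
      case False
      with x have "x \<noteq> y" "x \<in> letters (u @ v)" by (auto split: if_splits)
      then show ?thesis using ren[of x "u @ v"] False assms by (force simp: quadratic_def)
    qed
  qed
qed

lemma quadratic_spur:
  assumes "quadratic (u @ (z, s) # (z, t) # v)"
  shows "quadratic (u @ v)" "z \<notin> letters (u @ v)"
proof -
  have "occ z (u @ v) = 0" using assms by (force simp: quadratic_def)
  then show z: "z \<notin> letters (u @ v)" by (rule occ_eq_0_iff[THEN iffD1])
  show "quadratic (u @ v)"
    unfolding quadratic_def
  proof
    fix x assume "x \<in> letters (u @ v)"
    moreover from this z have "x \<noteq> z" by auto
    ultimately show "occ x (u @ v) = 2" using assms by (force simp: quadratic_def)
  qed
qed

text \<open>If all letters interlace pairwise, then between the two occurrences of a letter every other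
  letter occurs exactly once, so the two occurrences are always the same distance apart.\<close>

lemma square_if_interlaced:
  assumes quad: "quadratic w" and sign: "\<And>l. l \<in> set w \<Longrightarrow> snd l = s"
    and inter: "\<And>z y. z \<in> letters w \<Longrightarrow> y \<in> letters w \<Longrightarrow> mag z y w = 1"
  obtains u where "w = u @ u" "distinct (map fst u)"
proof -
  define k where "k = card (letters w)"
  have len: "length w = 2 * k"
    using quad length_eq_sum_occ[of "letters w" w] by (simp add: k_def quadratic_def)
  have shift: "w ! (i + k) = w ! i" if ik: "i < k" for i
  proof -
    define z where "z = fst (w ! i)"
    have zw: "z \<in> letters w" using ik len by (auto simp: z_def letters_def)
    obtain u s1 v s2 x where w: "w = u @ (z, s1) # v @ (z, s2) # x"
      "z \<notin> letters u" "z \<notin> letters v" "z \<notin> letters x"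
      using quadratic_split quad zw unfolding quadratic_def by metis
    have s12: "s1 = s2" using sign[of "(z, s1)"] sign[of "(z, s2)"] w(1) by simp
    have occ1: "occ y v = 1" if y: "y \<in> letters w" "y \<noteq> z" for y
    proof -
      \<comment> \<open>The first \<open>z\<close> sees the occurrences of \<open>y\<close> in
        \<open>v\<close> and \<open>x\<close>, the second those in \<open>x\<close>; modulo 2 only
        \<open>v\<close> remains.\<close>
      have "mag z y w = cnt y v"
        using w(2-4) y(2)
        by (cases "cnt y v"; cases "cnt y x") (simp_all add: w(1) mag_append mag_notin cnt_notin)
      then have "of_nat (occ y v) = (1 :: bit)" using inter[OF zw y(1)] by (simp add: cnt_eq_occ)
      then have "odd (occ y v)" by (metis even_of_nat odd_one)
      moreover have "occ y v \<le> occ y w" by (simp add: w(1))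
      then have "occ y v \<le> 2" using quad y(1) by (simp add: quadratic_def)
      ultimately show ?thesis by (cases "occ y v = 2") (auto simp: le_less less_Suc_eq numeral_2_eq_2)
    qed
    have "letters v \<subseteq> letters w - {z}" using w(1,3) by auto
    then have "length v = (\<Sum>y\<in>letters w - {z}. occ y v)" by (intro length_eq_sum_occ) auto
    also have "\<dots> = k - 1" using occ1 zw by (simp add: k_def)
    finally have lv: "length v = k - 1" .
    \<comment> \<open>The second occurrence of \<open>z\<close> is at position
      \<open>length u + k\<close>, too far to be \<open>i\<close>.\<close>
    have "i = length u"
    proof (rule ccontr)
      assume "i \<noteq> length u"
      then consider "i < length u" | "length u < i" "i < length u + k"
        using ik by force
      then show False
      proof cases
        case 1
        then have "w ! i \<in> set u" by (simp add: w(1) nth_append)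
        then show False using w(2) by (auto simp: z_def letters_def)
      next
        case 2
        then have "w ! i = v ! (i - Suc (length u))" "i - Suc (length u) < length v"
          using lv by (auto simp: w(1) nth_append nth_Cons')
        then have "w ! i \<in> set v" by simp
        then show False using w(3) by (auto simp: z_def letters_def)
      qed
    qed
    then show ?thesis using lv ik s12 by (simp add: w(1) nth_append nth_Cons')
  qed
  define u where "u = take k w"
  have "drop k w = take k w"
    by (rule nth_equalityI) (use len shift in \<open>auto simp: add.commute\<close>)
  then have w: "w = u @ u" unfolding u_def by (metis append_take_drop_id)
  have "distinct (map fst u)"
    by (rule distinct_if_occ_1) (use quad w in \<open>auto simp: quadratic_def\<close>)
  with w show ?thesis by (rule that)
qed

lemma mag_concat:
  assumes "\<And>w. w \<in> set ws \<Longrightarrow> cnt z w = 0"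
  shows "mag z y (concat ws) = sum_list (map (mag z y) ws)"
  using assms by (induction ws) (auto simp: mag_append)

text \<open>Cuts a path along a factorization of its label; distinct indices let one function record
  the pieces.\<close>

lemma rename_eq_concat:
  assumes "distinct is" "rename f w = concat (map h is)"
  obtains V where "w = concat (map V is)" "\<And>i. i \<in> set is \<Longrightarrow> rename f (V i) = h i"
proof -
  have "\<exists>V. w = concat (map V is) \<and> (\<forall>i\<in>set is. rename f (V i) = h i)"
    using assms
  proof (induction "is" arbitrary: w)
    case Nil
    then show ?case by (cases w) auto
  next
    case (Cons i "is")
    define v where "v = take (length (h i)) w"
    define w' where "w' = drop (length (h i)) w"
    have "rename f v = take (length (h i)) (rename f w)" "rename f w' = drop (length (h i)) (rename f w)"
      by (simp_all add: v_def w'_def rename_def take_map drop_map)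
    then have "rename f v = h i" "rename f w' = concat (map h is)"
      using Cons(3) by simp_all
    moreover from this Cons obtain V where "w' = concat (map V is)" "\<forall>i\<in>set is. rename f (V i) = h i"
      by auto
    moreover have "w = v @ w'" by (simp add: v_def w'_def)
    ultimately show ?case using Cons(2) by (intro exI[of _ "V(i := v)"]) (auto intro!: arg_cong[of _ _ concat])
  qed
  then show ?thesis using that by blast
qed

section \<open>Orthonormal systems over the field with two elements\<close>

text \<open>Pairing with \<open>c k\<close> recovers the coefficient \<open>e k\<close>, so forming
  linear combinations is injective on a finite set and hence surjective. Thus \<open>d\<close> is a
  combination of the \<open>c j\<close>, and its coefficients are its pairings with them, which
  vanish.\<close>

lemma orthonormal_complete:
  fixes c :: "nat \<Rightarrow> nat \<Rightarrow> bit"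
  assumes orth: "\<And>j k. j \<in> {1..g} \<Longrightarrow> k \<in> {1..g} \<Longrightarrow> (\<Sum>i=1..g. c j i * c k i) = of_bool (j = k)"
    and d: "\<And>j. j \<in> {1..g} \<Longrightarrow> (\<Sum>i=1..g. d i * c j i) = 0" and "i \<in> {1..g}"
  shows "d i = 0"
proof -
  define E where "E = ({1..g} \<rightarrow>\<^sub>E (UNIV :: bit set))"
  define M where "M = (\<lambda>e. \<lambda>i\<in>{1..g}. \<Sum>j=1..g. e j * c j i)"
  have M: "(\<Sum>i=1..g. M e i * c k i) = e k" if "k \<in> {1..g}" for e k
  proof -
    have "(\<Sum>i=1..g. M e i * c k i) = (\<Sum>i=1..g. \<Sum>j=1..g. e j * (c j i * c k i))"
      by (rule sum.cong) (simp_all only: M_def restrict_apply' sum_distrib_right mult.assoc)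
    also have "\<dots> = (\<Sum>j=1..g. e j * (\<Sum>i=1..g. c j i * c k i))"
      by (subst sum.swap) (simp only: sum_distrib_left)
    also have "\<dots> = (\<Sum>j=1..g. e j * of_bool (j = k))"
      using orth that by (intro sum.cong) auto
    also have "\<dots> = (\<Sum>j=1..g. if j = k then e j else 0)"
      by (intro sum.cong) auto
    finally show ?thesis using that by (simp only: sum.delta finite_atLeastAtMost if_True)
  qed
  have "(UNIV :: bit set) = {0, 1}" by auto
  then have "finite (UNIV :: bit set)" by (metis finite.emptyI finite.insertI)
  then have "finite E" by (simp add: E_def finite_PiE)
  moreover have "M ` E \<subseteq> E" by (auto simp: E_def M_def)
  moreover have "inj_on M E"
  proof (rule inj_onI)
    fix e e' assume "e \<in> E" "e' \<in> E" "M e = M e'"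
    then show "e = e'" using M[of _ e] M[of _ e'] unfolding E_def by (intro PiE_ext) auto
  qed
  ultimately have "M ` E = E" by (rule endo_inj_surj)
  moreover have "restrict d {1..g} \<in> E" by (auto simp: E_def)
  ultimately obtain e where e: "restrict d {1..g} = M e" by blast
  have "e k = 0" if "k \<in> {1..g}" for k
    using M[OF that, of e] d[OF that] by (simp flip: e)
  then have "(\<Sum>j=1..g. e j * c j i) = 0" by (intro sum.neutral) auto
  then have "M e i = 0" using \<open>i \<in> {1..g}\<close> by (simp only: M_def restrict_apply')
  then show ?thesis using e \<open>i \<in> {1..g}\<close> by (metis restrict_apply')
qed

section \<open>Paths in labelled graphs\<close>

text \<open>A graph with edge set \<open>'z\<close> is given by \<open>en\<close>: the edge \<open>e\<close> runs from \<open>en e False\<close> to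
  \<open>en e True\<close>. A word is read as an edge path.\<close>

abbreviation start :: "('z \<Rightarrow> bool \<Rightarrow> 'v) \<Rightarrow> 'z \<times> bool \<Rightarrow> 'v" where
  "start en l \<equiv> en (fst l) (\<not> snd l)"

abbreviation finish :: "('z \<Rightarrow> bool \<Rightarrow> 'v) \<Rightarrow> 'z \<times> bool \<Rightarrow> 'v" where
  "finish en l \<equiv> en (fst l) (snd l)"

fun path :: "('z \<Rightarrow> bool \<Rightarrow> 'v) \<Rightarrow> 'v \<Rightarrow> 'z word \<Rightarrow> 'v \<Rightarrow> bool" where
  "path en u [] v \<longleftrightarrow> u = v"
| "path en u (l # w) v \<longleftrightarrow> start en l = u \<and> path en (finish en l) w v"

lemma path_append: "path en u (p @ q) v \<longleftrightarrow> (\<exists>m. path en u p m \<and> path en m q v)"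
  by (induction p arbitrary: u) auto

lemma path_winv: "path en u w v \<Longrightarrow> path en v (winv w) u"
  by (induction w arbitrary: u) (auto simp: path_append)

lemma path_start: "path en u w v \<Longrightarrow> w \<noteq> [] \<Longrightarrow> u = start en (hd w)"
  by (cases w) auto

lemma path_finish: "path en u w v \<Longrightarrow> w \<noteq> [] \<Longrightarrow> v = finish en (last w)"
  by (induction w arbitrary: u) (auto split: if_splits)

lemma path_nth:
  assumes "path en u w v" "Suc j < length w"
  shows "finish en (w ! j) = start en (w ! Suc j)"
  using assms
proof (induction w arbitrary: u j)
  case (Cons l w)
  show ?case
  proof (cases j)
    case 0
    then show ?thesis using Cons(2,3) by (cases w) auto
  next
    case (Suc k)
    then show ?thesis using Cons by auto
  qed
qed simp

lemma path_take:
  assumes "path en u w v" "j < length w"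
  shows "path en u (take j w) (start en (w ! j))"
proof -
  have "path en u (take j w @ w ! j # drop (Suc j) w) v"
    using assms by (simp flip: id_take_nth_drop)
  then show ?thesis unfolding path_append by auto
qed

lemma path_if_vertices:
  assumes "\<And>j. j < length w \<Longrightarrow> start en (w ! j) = t j \<and> finish en (w ! j) = t (Suc j)"
  shows "path en (t 0) w (t (length w))"
  using assms
proof (induction w arbitrary: t)
  case (Cons l w)
  have "path en (t (Suc 0)) w (t (Suc (length w)))"
    using Cons(2)[of "Suc _"] by (intro Cons(1)[of "\<lambda>j. t (Suc j)"]) auto
  then show ?case using Cons(2)[of 0] by simp
qed simp

lemma path_map:
  "path en u w v \<Longrightarrow> (\<And>e t. e \<in> letters w \<Longrightarrow> en' (f e) t = r (en e t)) \<Longrightarrow>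
    path en' (r u) (rename f w) (r v)"
  by (induction w arbitrary: u) auto

lemma path_to_end:
  assumes "path en u w v" "e \<in> letters w"
  obtains R where "path en u R (en e t)" "letters R \<subseteq> letters w"
proof -
  obtain s where "(e, s) \<in> set w" using assms(2) by (auto simp: letters_def)
  then obtain p q where w: "w = p @ (e, s) # q" by (meson split_list)
  then obtain p: "path en u p (en e (\<not> s))" using assms(1) by (auto simp: path_append)
  show ?thesis
  proof (cases "t = s")
    case True
    then show ?thesis using that[of "p @ [(e, s)]"] p w by (auto simp: path_append)
  next
    case False
    then have "t = (\<not> s)" by simp
    then show ?thesis using that[of p] p w by auto
  qed
qed

text \<open>\<open>t v\<close> plays the role of the path to \<open>v\<close> in a spanning tree.\<close>

lemma path_feq_tree:
  assumes t0: "t v\<^sub>0 = []"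
    and edge: "\<And>e. e \<in> A \<Longrightarrow>
      \<exists>s J. letters J \<subseteq> I \<and> t (en e (\<not> s)) @ [(e, s)] \<sim> subst_word P J @ t (en e s)"
    and "path en v\<^sub>0 Q v" "letters Q \<subseteq> A"
  shows "\<exists>J. letters J \<subseteq> I \<and> Q \<sim> subst_word P J @ t v"
  using assms(3,4)
proof (induction Q arbitrary: v rule: rev_induct)
  case Nil
  then show ?case using t0 by (intro exI[of _ "[]"]) auto
next
  case (snoc l Q)
  obtain e s where l: "l = (e, s)" by fastforce
  have path: "path en v\<^sub>0 Q (en e (\<not> s))" "v = en e s" and e: "e \<in> A" "letters Q \<subseteq> A"
    using snoc(2,3) by (auto simp: l path_append)
  obtain J where J: "letters J \<subseteq> I" "Q \<sim> subst_word P J @ t (en e (\<not> s))"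
    using snoc(1)[OF path(1) e(2)] by blast
  obtain s' K where K: "letters K \<subseteq> I" "t (en e (\<not> s')) @ [(e, s')] \<sim> subst_word P K @ t (en e s')"
    using edge[OF e(1)] by blast
  \<comment> \<open>The hypothesis treats one direction of each edge; the other direction follows by
    inverting.\<close>
  have "\<exists>K. letters K \<subseteq> I \<and> t (en e (\<not> s)) @ [(e, s)] \<sim> subst_word P K @ t (en e s)"
  proof (cases "s' = s")
    case True
    with K show ?thesis by blast
  next
    case False
    then have s': "s' = (\<not> s)" by simp
    have "winv (subst_word P K) @ (t (en e s) @ [(e, \<not> s)]) \<sim>
        winv (subst_word P K) @ (subst_word P K @ t (en e (\<not> s)))"
      using K(2) by (intro feq_append[OF feq_refl]) (simp add: s')
    also have "\<dots> \<sim> t (en e (\<not> s))"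
      using feq_append[OF feq_winv_append[of "subst_word P K"] feq_refl[of "t (en e (\<not> s))"]] by simp
    finally have "(winv (subst_word P K) @ t (en e s)) @ [(e, \<not> s)] \<sim> t (en e (\<not> s))"
      by simp
    from feq_move_winv[OF this]
    have "t (en e (\<not> s)) @ [(e, s)] \<sim> subst_word P (winv K) @ t (en e s)"
      by (simp add: subst_word_winv)
    then show ?thesis using K(1) by (intro exI[of _ "winv K"]) simp
  qed
  then obtain K where K: "letters K \<subseteq> I" "t (en e (\<not> s)) @ [(e, s)] \<sim> subst_word P K @ t (en e s)"
    by blast
  have "Q @ [l] \<sim> subst_word P J @ (t (en e (\<not> s)) @ [(e, s)])"
    using feq_append[OF J(2) feq_refl[of "[l]"]] by (simp add: l)
  also have "\<dots> \<sim> subst_word P J @ (subst_word P K @ t (en e s))"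
    by (rule feq_append[OF feq_refl K(2)])
  finally show ?case
    using J(1) K(1) path(2) by (intro exI[of _ "J @ K"]) simp
qed

text \<open>By the hypothesis \<open>disj\<close> the closed paths \<open>U i\<close> do not meet except at the base point and along
  common initial segments.\<close>

lemma closed_path_feq_petals:
  assumes U: "\<And>i. i \<in> I \<Longrightarrow> path en v\<^sub>0 (U i) v\<^sub>0"
    and disj: "\<And>i j i' j'. i \<in> I \<Longrightarrow> i' \<in> I \<Longrightarrow> j < length (U i) \<Longrightarrow> j' < length (U i') \<Longrightarrow>
      start en (U i ! j) = start en (U i' ! j') \<Longrightarrow> take j (U i) = take j' (U i')"
    and "path en v\<^sub>0 Q v\<^sub>0" "letters Q \<subseteq> (\<Union>i\<in>I. letters (U i))"
  shows "\<exists>J. letters J \<subseteq> I \<and> Q \<sim> subst_word U J"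
proof -
  define rep where "rep = (\<lambda>v w. \<exists>i\<in>I. \<exists>j<length (U i). start en (U i ! j) = v \<and> w = take j (U i))"
  \<comment> \<open>All candidates for a vertex agree by \<open>disj\<close>. Vertices without a
    candidate get the empty path.\<close>
  define t where "t = (\<lambda>v. if \<exists>w. rep v w then SOME w. rep v w else [])"
  have t: "t v = w" if "rep v w" for v w
  proof -
    have "\<exists>w. rep v w" using that by blast
    then have "rep v (t v)" unfolding t_def by (simp add: someI_ex)
    then obtain i j where i: "i \<in> I" "j < length (U i)" "start en (U i ! j) = v" "t v = take j (U i)"
      unfolding rep_def by blast
    obtain i' j' where "i' \<in> I" "j' < length (U i')" "start en (U i' ! j') = v" "w = take j' (U i')"
      using \<open>rep v w\<close> unfolding rep_def by blast
    then show ?thesis using i disj[of i i' j j'] by simp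
  qed
  have t0: "t v\<^sub>0 = []"
  proof (cases "\<exists>w. rep v\<^sub>0 w")
    case True
    then obtain i j where i: "i \<in> I" "j < length (U i)" by (auto simp: rep_def)
    then have "U i \<noteq> []" by auto
    then have "start en (U i ! 0) = v\<^sub>0" using path_start[OF U[OF i(1)]] by (simp add: hd_conv_nth)
    then have "rep v\<^sub>0 (take 0 (U i))" using i \<open>U i \<noteq> []\<close> unfolding rep_def by blast
    then show ?thesis using t by fastforce
  next
    case False
    then show ?thesis unfolding t_def by (rule if_not_P)
  qed
  have "\<exists>s J. letters J \<subseteq> I \<and> t (en e (\<not> s)) @ [(e, s)] \<sim> subst_word U J @ t (en e s)"
    if e: "e \<in> (\<Union>i\<in>I. letters (U i))" for e
  proof -
    obtain i s where i: "i \<in> I" "(e, s) \<in> set (U i)" using e by (auto simp: letters_def)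
    then obtain j where j: "j < length (U i)" "U i ! j = (e, s)" by (auto simp: in_set_conv_nth)
    have "rep (en e (\<not> s)) (take j (U i))"
      unfolding rep_def using i(1) j by (intro bexI[of _ i] exI[of _ j]) auto
    then have src: "t (en e (\<not> s)) @ [(e, s)] = take (Suc j) (U i)"
      using t j by (simp add: take_Suc_conv_app_nth)
    show ?thesis
    proof (cases "Suc j < length (U i)")
      case True
      have "finish en (U i ! j) = start en (U i ! Suc j)" by (rule path_nth[OF U[OF i(1)] True])
      then have "rep (en e s) (take (Suc j) (U i))"
        unfolding rep_def using i(1) j True by (intro bexI[of _ i] exI[of _ "Suc j"]) auto
      then show ?thesis using t src by (intro exI[of _ s] exI[of _ "[]"]) simp
    next
      \<comment> \<open>Only the last edge of a petal leaves the tree; it closes the petal and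
        contributes the generator \<open>i\<close>.\<close>
      case False
      then have len: "Suc j = length (U i)" using j by simp
      then have "last (U i) = (e, s)" using j by (metis diff_Suc_1 last_conv_nth length_0_conv nat.simps(3))
      then have "en e s = v\<^sub>0" using path_finish[OF U[OF i(1)]] j by fastforce
      then show ?thesis using t0 src len i(1) by (intro exI[of _ s] exI[of _ "[(i, True)]"]) simp
    qed
  qed
  from path_feq_tree[where t = t, OF t0 this assms(3,4)] show ?thesis using t0 by simp
qed

lemma path_squares:
  assumes "path en v (concat (map (\<lambda>i. U i @ U i) is)) v'" "\<And>i. i \<in> set is \<Longrightarrow> U i \<noteq> []"
  shows "\<forall>i\<in>set is. path en v (U i) v"
  using assms
proof (induction "is")
  case (Cons i "is")
  then obtain m m' where m: "path en v (U i) m" "path en m (U i) m'"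
    "path en m' (concat (map (\<lambda>i. U i @ U i) is)) v'"
    by (auto simp: path_append)
  have "U i \<noteq> []" using Cons(3) by simp
  then have "v = m" "m = m'"
    using m path_start path_finish by metis+
  then show ?case using m Cons by auto
qed simp

text \<open>Folding two edges with a common endpoint is surjective on fundamental groups, whether or not
  their other endpoints are distinct.\<close>

lemma fold_path_lift:
  assumes zy: "en z s = en y s"
    and r: "r = (\<lambda>v. if v = en y (\<not> s) then en z (\<not> s) else v)"
    and "path (\<lambda>e t. r (en e t)) (r u) Q' (r v)"
  shows "\<exists>Q. path en u Q v \<and> letters Q \<subseteq> letters Q' \<union> {z, y} \<and>
    rename (id(y := z)) Q \<sim> rename (id(y := z)) Q'"
proof -
  \<comment> \<open>Vertices identified by the fold are joined by the detour along \<open>z\<close>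
    and back along \<open>y\<close>, which cancels once both edges have become \<open>z\<close>.
    Inserting detours repairs every gap in a lifted path.\<close>
  have jump: "\<exists>Q. path en u Q v \<and> letters Q \<subseteq> {z, y} \<and> rename (id(y := z)) Q \<sim> []"
    if "r u = r v" for u v
  proof -
    let ?Q = "[(z, s), (y, \<not> s)]"
    have Q: "path en (en z (\<not> s)) ?Q (en y (\<not> s))" using zy by simp
    have ren: "rename (id(y := z)) ?Q \<sim> []" using feq_cancel[of "[]" z s "[]"] by (cases "z = y") auto
    consider "u = v" | "u = en z (\<not> s)" "v = en y (\<not> s)" | "u = en y (\<not> s)" "v = en z (\<not> s)"
      using \<open>r u = r v\<close> unfolding r by (auto split: if_splits)
    then show ?thesis
    proof cases
      case 1
      then show ?thesis by (intro exI[of _ "[]"]) simp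
    next
      case 2
      then show ?thesis using Q ren by (intro exI[of _ ?Q]) auto
    next
      case 3
      then show ?thesis using path_winv[OF Q] feq_winv[OF ren] by (intro exI[of _ "winv ?Q"]) auto
    qed
  qed
  show ?thesis
    using assms(3)
  proof (induction Q' arbitrary: u)
    case Nil
    then have "r u = r v" by simp
    then show ?case unfolding letters_simps rename_simps Un_empty_left by (rule jump)
  next
    case (Cons l Q')
    then have "r u = r (start en l)" and Q': "path (\<lambda>e t. r (en e t)) (r (finish en l)) Q' (r v)"
      by auto
    from jump[OF this(1)] obtain Q1 where Q1: "path en u Q1 (start en l)" "letters Q1 \<subseteq> {z, y}"
      "rename (id(y := z)) Q1 \<sim> []" by blast
    from Cons(1)[OF Q'] obtain Q2 where Q2: "path en (finish en l) Q2 v" "letters Q2 \<subseteq> letters Q' \<union> {z, y}"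
      "rename (id(y := z)) Q2 \<sim> rename (id(y := z)) Q'" by blast
    have "path en u (Q1 @ l # Q2) v" using Q1 Q2 by (auto simp: path_append)
    moreover have "letters (Q1 @ l # Q2) \<subseteq> letters (l # Q') \<union> {z, y}" using Q1 Q2 by auto
    moreover have "rename (id(y := z)) (Q1 @ l # Q2) \<sim> rename (id(y := z)) (l # Q')"
      using feq_append[OF Q1(3) feq_append[OF feq_refl[of "rename (id(y := z)) [l]"] Q2(3)]] by simp
    ultimately show ?case by blast
  qed
qed

section \<open>Solutions as quadratic words\<close>

lemma sum_list_single:
  assumes "distinct is" "i \<in> set is" "\<And>j. j \<in> set is \<Longrightarrow> j \<noteq> i \<Longrightarrow> f j = 0"
  shows "sum_list (map f is) = (f i :: 'a :: comm_monoid_add)"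
proof -
  have "sum_list (map f is) = sum f (set is)"
    using assms(1) by (rule sum_list_distinct_conv_sum_set)
  also have "\<dots> = sum f {i}"
    using assms(2,3) by (intro sum.mono_neutral_right) auto
  finally show ?thesis by simp
qed

lemma occ_concat: "occ z (concat ws) = sum_list (map (occ z) ws)"
  by (induction ws) auto

section \<open>Substituting words for letters\<close>

lemma cnt_subst_word:
  "(\<And>i. i \<in> letters J \<Longrightarrow> cnt z (P i) = cnt y (P i)) \<Longrightarrow>
    cnt z (subst_word P J) = cnt y (subst_word P J)"
  by (induction J) auto

lemma feq_subst_word: "u \<sim> v \<Longrightarrow> subst_word f u \<sim> subst_word f v"
proof (induction rule: feq.induct)
  case (feq_cancel u z s v)
  have "subst_word f [(z, s), (z, \<not> s)] \<sim> []"
    using feq_append_winv[of "f z"] feq_winv_append[of "f z"] by (cases s) auto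
  from feq_context[OF this, of "subst_word f u" "subst_word f v"] show ?case by (cases s) auto
qed (auto intro: feq_sym feq_trans)

lemma feq_subst_word_cong:
  "(\<And>i. i \<in> letters J \<Longrightarrow> P i \<sim> P' i) \<Longrightarrow> subst_word P J \<sim> subst_word P' J"
  by (induction J) (auto intro!: feq_append feq_winv)

lemma subst_word_subst_word: "subst_word f (subst_word P J) = subst_word (\<lambda>i. subst_word f (P i)) J"
  by (induction J) (auto simp: subst_word_winv)

lemma subst_word_id: "(\<And>i. i \<in> letters J \<Longrightarrow> P i = [(i, True)]) \<Longrightarrow> subst_word P J = J"
  by (induction J) auto

lemma subst_word_empty: "(\<And>i. i \<in> letters J \<Longrightarrow> P i = []) \<Longrightarrow> subst_word P J = []"
  by (induction J) auto

lemma subst_word_sqprod: "subst_word f (sqprod P g) = sqprod (\<lambda>i. subst_word f (P i)) g"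
  by (induction g) (simp_all add: sqprod_Suc, simp_all add: sqprod_def)

lemma feq_sqprod: "(\<And>i. i \<in> {1..g} \<Longrightarrow> P i \<sim> P' i) \<Longrightarrow> sqprod P g \<sim> sqprod P' g"
proof (induction g)
  case (Suc g)
  then show ?case by (auto simp: sqprod_Suc intro!: feq_append)
qed (simp add: sqprod_def)

text \<open>Linear independence over the field with two elements of the mod 2 abelianizations of
  \<open>P 1\<close>, ..., \<open>P g\<close>.\<close>

definition independent :: "nat \<Rightarrow> (nat \<Rightarrow> 'z word) \<Rightarrow> bool" where
  "independent g P \<longleftrightarrow>
     (\<forall>d. (\<forall>z. (\<Sum>k=1..g. d k * cnt z (P k)) = 0) \<longrightarrow> (\<forall>k\<in>{1..g}. d k = 0))"

context group
begin

lemma val_replicate: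
  assumes "f b \<in> carrier G"
  shows "val G f (replicate k (b, s)) = (if s then f b [^] k else inv (f b [^] k))"
proof (induction k)
  case (Suc k)
  show ?case
  proof (cases s)
    case True
    then show ?thesis using Suc assms nat_pow_Suc2[of "f b" k] by (simp del: nat_pow_Suc)
  next
    case False
    then show ?thesis using Suc assms by (simp add: inv_mult_group)
  qed
qed simp

lemma val_replicate_int:
  assumes "f b \<in> carrier G"
  shows "val G f (replicate (nat \<bar>k\<bar>) (b, k > 0)) = f b [^] (k :: int)"
  by (cases "k > 0"; cases "k = 0") (simp_all add: val_replicate[of f b, OF assms] int_pow_def2 del: pow_nat)

end

section \<open>The target word and its interlacing form\<close>

locale square_target =
  fixes H :: "('h, 'm) monoid_scheme" and B :: "'h set" and a :: "nat \<Rightarrow> 'h"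
    and n :: "nat \<Rightarrow> int" and g :: nat
  assumes H: "free_basis H B"
    and aB: "\<And>i. i \<in> {1..g} \<Longrightarrow> a i \<in> B" and inj_a: "inj_on a {1..g}"
    and n0: "\<And>i. i \<in> {1..g} \<Longrightarrow> n i \<noteq> 0"
begin

sublocale group H
  using H by (rule free_basis_imp_group)

lemma B_carrier: "B \<subseteq> carrier H"
  using H by (rule free_basis_subset)

lemma a_carrier: "i \<in> {1..g} \<Longrightarrow> a i \<in> carrier H"
  using aB B_carrier by blast

definition T :: 'h where
  "T = ordered_prod H (\<lambda>i. a i [^]\<^bsub>H\<^esub> (2 * n i)) g"

definition block :: "nat \<Rightarrow> 'h word" where
  "block i = replicate (2 * nat \<bar>n i\<bar>) (a i, n i > 0)"

definition target_word :: "'h word" where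
  "target_word = concat (map block [1..<Suc g])"

text \<open>The \<open>a i\<close> are distinct, so equal generators always occur with equal
  exponents and nothing cancels.\<close>

lemma target_word_reduced: "target_word \<in> reduced_words B"
proof -
  have l: "\<exists>i\<in>{1..g}. l = (a i, n i > 0)" if "l \<in> set target_word" for l
    using that by (auto simp: target_word_def block_def simp del: upt_Suc)
  have "snd l = snd l'" if ll: "l \<in> set target_word" "l' \<in> set target_word" "fst l = fst l'" for l l'
  proof -
    obtain i i' where "i \<in> {1..g}" "i' \<in> {1..g}" "l = (a i, n i > 0)" "l' = (a i', n i' > 0)"
      using l[OF ll(1)] l[OF ll(2)] by blast
    moreover from this have "i = i'" using ll(3) inj_onD[OF inj_a] by simp
    ultimately show ?thesis by simp
  qed
  then have "reduced target_word"
    unfolding reduced_def successively_nth_iff by (auto split: prod.splits) (metis Suc_lessD fst_conv nth_mem snd_conv)+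
  moreover have "letters target_word \<subseteq> B"
    using l aB by (fastforce simp: letters_def)
  ultimately show ?thesis by (simp add: reduced_words_iff)
qed

lemma target_word_value: "word_value H target_word = T"
proof -
  have "word_value H (concat (map block is)) = foldr (\<lambda>i r. a i [^]\<^bsub>H\<^esub> (2 * n i) \<otimes>\<^bsub>H\<^esub> r) is \<one>\<^bsub>H\<^esub>"
    if "set is \<subseteq> {1..g}" for "is"
    using that
  proof (induction "is")
    case (Cons i "is")
    have c: "(\<lambda>b. b) ` letters (block i) \<subseteq> carrier H" if "i \<in> {1..g}" for i
      using a_carrier[OF that] by (auto simp: block_def letters_def)
    have "block i = replicate (nat \<bar>2 * n i\<bar>) (a i, 2 * n i > 0)"
      by (simp add: block_def abs_mult nat_mult_distrib)
    then have "val H (\<lambda>b. b) (block i) = a i [^]\<^bsub>H\<^esub> (2 * n i)"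
      using val_replicate_int[of "\<lambda>b. b" "a i" "2 * n i"] a_carrier Cons(2) by simp
    moreover have "(\<lambda>b. b) ` letters (concat (map block is)) \<subseteq> carrier H"
      using c Cons(2) by fastforce
    ultimately show ?case
      using Cons c[of i] by (simp add: word_value_eq_val val_append)
  qed (simp add: word_value_eq_val)
  from this[of "[1..<Suc g]"] show ?thesis
    unfolding target_word_def T_def ordered_prod_def by (simp add: atLeastLessThanSuc_atLeastAtMost del: upt_Suc)
qed

lemma labels_eq_target_word:
  assumes "\<beta> ` letters W \<subseteq> B" "val H \<beta> W = T" "reduced (rename \<beta> W)"
  shows "rename \<beta> W = target_word"
proof -
  have "rename \<beta> W \<in> reduced_words B" using assms by (simp add: reduced_words_iff)
  moreover have "word_value H (rename \<beta> W) = word_value H target_word"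
    using assms(2) by (simp add: word_value_eq_val val_rename flip: target_word_value)
  ultimately show ?thesis
    using H target_word_reduced unfolding free_basis_def bij_betw_def by (blast dest: inj_onD)
qed

text \<open>Letters in different blocks of the target word do not interlace, and both exponents of a letter
  agree. So the vectors \<open>k \<mapsto> cnt z (P k)\<close>, for one letter \<open>z\<close> from every block, form an orthonormal
  basis, and all letters of one block have the same vector; hence they interlace pairwise.\<close>

lemma folded_word_structure:
  assumes quad: "quadratic W" and "\<beta> ` letters W \<subseteq> B" "val H \<beta> W = T" "reduced (rename \<beta> W)"
    and P: "W \<sim> sqprod P g"
  shows "independent g P"
    and "\<exists>u. W = sqprod u g \<and> (\<forall>i\<in>{1..g}. distinct (map fst (u i)) \<and>
      rename \<beta> (u i) = replicate (nat \<bar>n i\<bar>) (a i, n i > 0) \<and>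
      (\<forall>z\<in>letters (u i). \<forall>y\<in>letters (u i). \<forall>k\<in>{1..g}. cnt z (P k) = cnt y (P k)))"
proof -
  have labels: "rename \<beta> W = concat (map block [1..<Suc g])"
    using labels_eq_target_word[OF assms(2-4)] by (simp add: target_word_def)
  have set_upt: "set [1..<Suc g] = {1..g}" by auto
  obtain V where V: "W = concat (map V [1..<Suc g])" "\<And>i. i \<in> {1..g} \<Longrightarrow> rename \<beta> (V i) = block i"
    using rename_eq_concat[OF _ labels] unfolding set_upt by (metis distinct_upt)
  have \<beta>V: "\<beta> z = a i" if "i \<in> {1..g}" "z \<in> letters (V i)" for z i
  proof -
    have "\<beta> z \<in> letters (block i)" using that V(2)[OF that(1), symmetric] by simp
    then show ?thesis by (auto simp: block_def letters_def)
  qed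
  have sign: "snd l = (n i > 0)" if "i \<in> {1..g}" "l \<in> set (V i)" for l i
  proof -
    have "(\<beta> (fst l), snd l) \<in> set (rename \<beta> (V i))" using that by (force simp: rename_def)
    then show ?thesis using V(2)[OF that(1)] by (simp add: block_def)
  qed
  have disj: "i = j" if "i \<in> {1..g}" "j \<in> {1..g}" "z \<in> letters (V i)" "z \<in> letters (V j)" for i j z
    using \<beta>V that inj_a by (metis inj_onD)
  have inW: "z \<in> letters W" if "i \<in> {1..g}" "z \<in> letters (V i)" for i z
    using that by (auto simp: V(1) simp del: upt_Suc)
  have occV: "occ z (V i) = 2" if "i \<in> {1..g}" "z \<in> letters (V i)" for i z
  proof -
    have "occ z W = sum_list (map (\<lambda>i. occ z (V i)) [1..<Suc g])"
      by (simp add: V(1) occ_concat comp_def del: upt_Suc)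
    also have "\<dots> = occ z (V i)"
    proof (rule sum_list_single)
      fix j assume "j \<in> set [1..<Suc g]" "j \<noteq> i"
      then show "occ z (V j) = 0" unfolding occ_eq_0_iff set_upt using disj[OF that(1) _ that(2)] by blast
    qed (use that in \<open>simp_all add: set_upt del: upt_Suc\<close>)
    finally show ?thesis using quad inW[OF that] by (simp add: quadratic_def)
  qed
  have cntV: "cnt z (V i) = 0" if "i \<in> {1..g}" for i z
    using occV[OF that] occ_eq_0_iff[of z "V i"] by (cases "z \<in> letters (V i)") (auto simp: cnt_eq_occ)
  \<comment> \<open>Each letter occurs twice within its own block, so the blocks have no linear
    terms and produce no cross terms.\<close>
  have magV: "mag z y W = sum_list (map (\<lambda>i. mag z y (V i)) [1..<Suc g])" for z y
    unfolding V(1) using cntV by (subst mag_concat) (auto simp: comp_def simp del: upt_Suc)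
  have mag_same: "mag z y W = mag z y (V i)" if "i \<in> {1..g}" "z \<in> letters (V i)" for i z y
    unfolding magV
  proof (rule sum_list_single)
    fix j assume "j \<in> set [1..<Suc g]" "j \<noteq> i"
    then have "z \<notin> letters (V j)" unfolding set_upt using disj[OF that(1) _ that(2)] by blast
    then show "mag z y (V j) = 0" by (simp add: mag_notin)
  qed (use that in \<open>simp_all add: set_upt del: upt_Suc\<close>)
  have mag_self1: "mag z z W = 1" if "i \<in> {1..g}" "z \<in> letters (V i)" for i z
    unfolding mag_same[OF that] using occV[OF that] sign[OF that(1)] by (rule mag_self)
  have mag_diff: "mag z y W = 0"
    if "i \<in> {1..g}" "j \<in> {1..g}" "i \<noteq> j" "z \<in> letters (V i)" "y \<in> letters (V j)" for i j z y
  proof -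
    have "y \<notin> letters (V i)" using disj[OF that(1,2) _ that(5)] that(3) by blast
    then show ?thesis unfolding mag_same[OF that(1,4)] by (simp add: mag_notin)
  qed
  have magP: "mag z y W = (\<Sum>k=1..g. cnt z (P k) * cnt y (P k))" for z y
    using mag_feq[OF P] by (simp only: mag_sqprod)
  have len: "length (V i) = 2 * nat \<bar>n i\<bar>" if "i \<in> {1..g}" for i
    using arg_cong[OF V(2)[OF that], of length] by (simp add: block_def)
  \<comment> \<open>One representative letter per block; blocks are nonempty because
    \<open>n i\<close> is nonzero.\<close>
  define r where "r = (\<lambda>i. fst (hd (V i)))"
  have r: "r i \<in> letters (V i)" if "i \<in> {1..g}" for i
  proof -
    have "V i \<noteq> []" using len[OF that] n0[OF that] by auto
    then show ?thesis by (simp add: r_def letters_def)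
  qed
  have orth: "(\<Sum>k=1..g. cnt (r i) (P k) * cnt (r j) (P k)) = of_bool (i = j)"
    if "i \<in> {1..g}" "j \<in> {1..g}" for i j
  proof (cases "i = j")
    case True
    then show ?thesis using mag_self1[OF that(1) r[OF that(1)]] by (simp only: flip: magP) simp
  next
    case False
    then show ?thesis using mag_diff[OF that False r[OF that(1)] r[OF that(2)]] by (simp only: flip: magP) simp
  qed
  note complete = orthonormal_complete[where c = "\<lambda>i k. cnt (r i) (P k)", OF orth]
  show "independent g P"
    unfolding independent_def
  proof (intro allI impI ballI)
    fix d :: "nat \<Rightarrow> bit" and k
    assume "\<forall>z. (\<Sum>k=1..g. d k * cnt z (P k)) = 0" "k \<in> {1..g}"
    then show "d k = 0" by (intro complete[of d]) auto
  qed
  have cnt_block: "cnt y (P k) = cnt (r i) (P k)"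
    if i: "i \<in> {1..g}" and y: "y \<in> letters (V i)" and k: "k \<in> {1..g}" for i y k
  proof -
    \<comment> \<open>\<open>t\<close> is the pairing of the vectors of \<open>y\<close> and
      \<open>r i\<close>. In characteristic 2 the sum below is \<open>y\<close> minus its
      projection, orthogonal to all representatives and hence zero.\<close>
    define t where "t = mag y (r i) W"
    have eq: "cnt y (P k) + t * cnt (r i) (P k) = 0" if "k \<in> {1..g}" for k
    proof (rule complete[of "\<lambda>k. cnt y (P k) + t * cnt (r i) (P k)", OF _ _ _ that])
      fix j assume j: "j \<in> {1..g}"
      have "(\<Sum>k=1..g. (cnt y (P k) + t * cnt (r i) (P k)) * cnt (r j) (P k)) =
          mag y (r j) W + t * mag (r i) (r j) W"
        by (simp only: magP distrib_right sum.distrib sum_distrib_left mult.assoc)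
      also have "\<dots> = 0"
      proof (cases "i = j")
        case True
        then have "mag (r i) (r j) W = 1" using mag_self1[OF i r[OF i]] by simp
        then show ?thesis using True by (simp add: t_def)
      next
        case False
        then have "mag y (r j) W = 0" "mag (r i) (r j) W = 0"
          using mag_diff[OF i j] y r i j by auto
        then show ?thesis by simp
      qed
      finally show "(\<Sum>k=1..g. (cnt y (P k) + t * cnt (r i) (P k)) * cnt (r j) (P k)) = 0" .
    qed
    \<comment> \<open>Otherwise \<open>y\<close> would have the zero vector, against its diagonal
      coefficient 1.\<close>
    have "t = 1"
    proof (rule ccontr)
      assume "t \<noteq> 1"
      then have "t = 0" by simp
      then have "cnt y (P k) = 0" if "k \<in> {1..g}" for k using eq[OF that] by simp
      then have "mag y y W = 0" unfolding magP by (intro sum.neutral) auto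
      then show False using mag_self1[OF i y] by simp
    qed
    then show ?thesis
      using eq[OF k] by (cases "cnt y (P k)"; cases "cnt (r i) (P k)") simp_all
  qed
  have "\<exists>v. V i = v @ v \<and> distinct (map fst v)" if i: "i \<in> {1..g}" for i
  proof -
    have quadV: "quadratic (V i)" using occV[OF i] by (simp add: quadratic_def)
    have magV1: "mag z y (V i) = 1" if "z \<in> letters (V i)" "y \<in> letters (V i)" for z y
    proof -
      have "mag z y (V i) = (\<Sum>k=1..g. cnt (r i) (P k) * cnt (r i) (P k))"
        unfolding mag_same[OF i that(1), symmetric] magP
        using cnt_block[OF i that(1)] cnt_block[OF i that(2)] by (intro sum.cong) auto
      also have "\<dots> = 1" using orth[OF i i] by simp
      finally show ?thesis .
    qed
    obtain v where "V i = v @ v" "distinct (map fst v)"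
      by (rule square_if_interlaced[OF quadV sign[OF i] magV1])
    then show ?thesis by blast
  qed
  then obtain u where u: "\<And>i. i \<in> {1..g} \<Longrightarrow> V i = u i @ u i"
    "\<And>i. i \<in> {1..g} \<Longrightarrow> distinct (map fst (u i))" by metis
  have "W = sqprod u g"
    unfolding V(1) sqprod_def using u(1) by (intro arg_cong[of _ _ concat] map_cong) (auto simp del: upt_Suc)
  moreover have "rename \<beta> (u i) = replicate (nat \<bar>n i\<bar>) (a i, n i > 0)" if "i \<in> {1..g}" for i
  proof -
    have "length (u i) = nat \<bar>n i\<bar>" using len[OF that] u(1)[OF that] by simp
    then have "rename \<beta> (u i) = take (nat \<bar>n i\<bar>) (rename \<beta> (V i))" using u(1)[OF that] by simp
    then show ?thesis using V(2)[OF that] by (simp add: block_def)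
  qed
  ultimately show "\<exists>u. W = sqprod u g \<and> (\<forall>i\<in>{1..g}. distinct (map fst (u i)) \<and>
      rename \<beta> (u i) = replicate (nat \<bar>n i\<bar>) (a i, n i > 0) \<and>
      (\<forall>z\<in>letters (u i). \<forall>y\<in>letters (u i). \<forall>k\<in>{1..g}. cnt z (P k) = cnt y (P k)))"
  proof (intro exI[of _ u] conjI ballI)
    fix i z y k assume "i \<in> {1..g}" "z \<in> letters (u i)" "y \<in> letters (u i)" "k \<in> {1..g}"
    then show "cnt z (P k) = cnt y (P k)" using cnt_block[of i z k] cnt_block[of i y k] u(1)[of i] by simp
  qed (use u(2) in blast)+
qed

section \<open>Folding of words, without the graph\<close>

lemma not_reduced_labels:
  assumes "\<not> reduced (rename \<beta> W)"
  obtains p z s y q where "W = p @ (z, s) # (y, \<not> s) # q" "\<beta> z = \<beta> y"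
proof -
  have "\<not> successively (\<lambda>l l'. \<not> (\<beta> (fst l) = \<beta> (fst l') \<and> snd l \<noteq> snd l')) W"
    using assms by (simp add: reduced_def rename_def successively_map case_prod_beta)
  then obtain p l l' q where "W = p @ l # l' # q" "\<beta> (fst l) = \<beta> (fst l')" "snd l \<noteq> snd l'"
    using not_successively_split by blast
  then show ?thesis using that[of p "fst l" "snd l" "fst l'" q] by (cases l; cases l') auto
qed

lemma fold_val:
  assumes "range \<beta> \<subseteq> carrier H" "\<beta> z = \<beta> y"
  shows "val H \<beta> (rename (id(y := z)) (p @ q)) = val H \<beta> (p @ (z, s) # (y, \<not> s) # q)"
proof -
  have \<beta>: "(\<lambda>x. \<beta> ((id(y := z)) x)) = \<beta>" using assms(2) by auto
  have ren: "val H \<beta> (rename (id(y := z)) w) = val H \<beta> w" for w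
    unfolding val_rename \<beta> ..
  have "rename (id(y := z)) (p @ (z, s) # (y, \<not> s) # q) \<sim> rename (id(y := z)) (p @ q)"
    using feq_cancel[of "rename (id(y := z)) p" z s "rename (id(y := z)) q"] by (cases "z = y") auto
  from val_feq[OF this assms(1)] show ?thesis by (simp only: ren)
qed

lemma fold_feq:
  assumes "p @ (z, s) # (y, \<not> s) # q \<sim> sqprod P g"
  shows "rename (id(y := z)) (p @ q) \<sim> sqprod (\<lambda>i. rename (id(y := z)) (P i)) g"
proof -
  have "rename (id(y := z)) (p @ q) \<sim> rename (id(y := z)) (p @ (z, s) # (y, \<not> s) # q)"
    using feq_sym[OF feq_cancel[of "rename (id(y := z)) p" z s "rename (id(y := z)) q"]]
    by (cases "z = y") auto
  also have "\<dots> \<sim> rename (id(y := z)) (sqprod P g)" by (rule feq_rename) (rule assms)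
  finally show ?thesis by (simp only: rename_sqprod)
qed

text \<open>This amounts to saying that the target is not a product of fewer than \<open>g\<close> squares.\<close>

lemma independent_if_value:
  assumes "quadratic W" "range \<beta> \<subseteq> carrier H" "\<beta> ` letters W \<subseteq> B" "val H \<beta> W = T" "W \<sim> sqprod P g"
  shows "independent g P"
  using assms
proof (induction "length W" arbitrary: W P rule: less_induct)
  case less
  show ?case
  proof (cases "reduced (rename \<beta> W)")
    case True
    then show ?thesis using folded_word_structure(1) less.prems by blast
  next
    case False
    then obtain p z s y q where W: "W = p @ (z, s) # (y, \<not> s) # q" and \<beta>: "\<beta> z = \<beta> y"
      by (rule not_reduced_labels)
    show ?thesis
    proof (cases "z = y")
      case True
      \<comment> \<open>The cancellation changes \<open>W\<close> only; the words \<open>P k\<close>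
        may still pass over the lost letter.\<close>
      have "p @ q \<sim> W" using feq_sym[OF feq_cancel[of p z s q]] W True by simp
      then have "p @ q \<sim> sqprod P g" using less.prems(5) feq_trans by blast
      moreover have "quadratic (p @ q)" using quadratic_spur(1)[of p z s "\<not> s" q] less.prems(1) W True by simp
      moreover have "val H \<beta> (p @ q) = T"
        using val_feq[OF \<open>p @ q \<sim> W\<close> less.prems(2)] less.prems(4) by simp
      ultimately show ?thesis using less.hyps[of "p @ q" P] less.prems(2,3) W by auto
    next
      case False
      define P' where "P' = (\<lambda>i. rename (id(y := z)) (P i))"
      define W' where "W' = rename (id(y := z)) (p @ q)"
      have "quadratic W'"
        using quadratic_fold(1)[of p z s y "\<not> s" q] less.prems(1) False unfolding W W'_def by simp
      moreover have "W' \<sim> sqprod P' g"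
        using less.prems(5) unfolding W W'_def P'_def by (rule fold_feq)
      moreover have "val H \<beta> W' = T"
        using fold_val[OF less.prems(2) \<beta>] less.prems(4) unfolding W W'_def by simp
      moreover have "\<beta> ` letters W' \<subseteq> B" using less.prems(3) by (auto simp: W W'_def)
      moreover have "length W' < length W" by (simp add: W W'_def)
      ultimately have ind: "independent g P'" using less.hyps[of W' P'] less.prems(2) by blast
      show ?thesis
        unfolding independent_def
      proof (intro allI impI)
        \<comment> \<open>Folding adds coordinate \<open>y\<close> to coordinate \<open>z\<close>
          and clears \<open>y\<close>, so a linear relation among the \<open>P k\<close> persists
          among the \<open>P' k\<close>.\<close>
        fix d :: "nat \<Rightarrow> bit" assume d: "\<forall>x. (\<Sum>k=1..g. d k * cnt x (P k)) = 0"
        have "(\<Sum>k=1..g. d k * cnt x (P' k)) = 0" for x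
        proof -
          consider "x = z" | "x = y" "x \<noteq> z" | "x \<noteq> y" "x \<noteq> z" by blast
          then show ?thesis
          proof cases
            case 1
            then have "(\<Sum>k=1..g. d k * cnt x (P' k)) =
                (\<Sum>k=1..g. d k * cnt z (P k)) + (\<Sum>k=1..g. d k * cnt y (P k))"
              by (simp only: P'_def cnt_rename_upd[OF False] simp_thms if_True distrib_left sum.distrib)
            then show ?thesis using d by simp
          next
            case 2
            then show ?thesis by (simp add: P'_def cnt_rename_upd[OF False])
          next
            case 3
            then show ?thesis using d by (simp only: P'_def cnt_rename_upd[OF False] simp_thms if_False)
          qed
        qed
        then show "\<forall>k\<in>{1..g}. d k = 0" using ind unfolding independent_def by blast
      qed
    qed
  qed
qed

end

section \<open>Folding\<close>

context square_target
begin

text \<open>A solution \<open>h\<close> is carried by closed paths \<open>P i\<close> in a graph whose edges are labelled by \<open>\<beta>\<close>. The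
  word \<open>W\<close> traverses every edge twice, the \<open>P i\<close> generate the fundamental group, and by the last
  clause no vertex other than the base point is a leaf, even after complete folding.\<close>

definition carries ::
  "('z \<Rightarrow> 'h) \<Rightarrow> (nat \<Rightarrow> 'h) \<Rightarrow> ('z \<Rightarrow> bool \<Rightarrow> 'v) \<Rightarrow> 'v \<Rightarrow> 'z word \<Rightarrow> (nat \<Rightarrow> 'z word) \<Rightarrow> bool"
  where
  "carries \<beta> h en v\<^sub>0 W P \<longleftrightarrow>
     quadratic W \<and> path en v\<^sub>0 W v\<^sub>0 \<and> \<beta> ` letters W \<subseteq> B \<and> val H \<beta> W = T \<and> W \<sim> sqprod P g \<and>
     (\<forall>i\<in>{1..g}. path en v\<^sub>0 (P i) v\<^sub>0 \<and> letters (P i) \<subseteq> letters W \<and> val H \<beta> (P i) = h i) \<and>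
     (\<forall>Q. path en v\<^sub>0 Q v\<^sub>0 \<and> letters Q \<subseteq> letters W \<longrightarrow> (\<exists>J. letters J \<subseteq> {1..g} \<and> Q \<sim> subst_word P J)) \<and>
     (\<forall>e\<in>letters W. \<forall>t. en e t \<noteq> v\<^sub>0 \<longrightarrow>
        (\<exists>l l'. fst l \<in> letters W \<and> fst l' \<in> letters W \<and> start en l = en e t \<and> start en l' = en e t \<and>
           (\<beta> (fst l), snd l) \<noteq> (\<beta> (fst l'), snd l')))"

text \<open>\<open>r\<close> identifies the far ends of the two edges and is the identity if they
  already agree. The leaf clause is phrased with labels because distinct edges may be merged,
  whereas distinct labelled directions stay distinct.\<close>

lemma carries_fold:
  fixes en :: "'z \<Rightarrow> bool \<Rightarrow> 'v"
  assumes c: "carries \<beta> h en v\<^sub>0 W P" and \<beta>: "range \<beta> \<subseteq> carrier H"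
    and W: "W = p @ (z, s) # (y, \<not> s) # q" and zy: "z \<noteq> y" "\<beta> z = \<beta> y"
  defines "f \<equiv> id(y := z)" and "r \<equiv> \<lambda>v. if v = en y (\<not> s) then en z (\<not> s) else v"
  shows "carries \<beta> h (\<lambda>e t. r (en e t)) (r v\<^sub>0) (rename f (p @ q)) (\<lambda>i. rename f (P i))"
proof -
  have quad: "quadratic W" and path: "path en v\<^sub>0 W v\<^sub>0" and \<beta>W: "\<beta> ` letters W \<subseteq> B" and val: "val H \<beta> W = T"
    and WP: "W \<sim> sqprod P g"
    and P: "\<And>i. i \<in> {1..g} \<Longrightarrow> path en v\<^sub>0 (P i) v\<^sub>0" "\<And>i. i \<in> {1..g} \<Longrightarrow> letters (P i) \<subseteq> letters W"
      "\<And>i. i \<in> {1..g} \<Longrightarrow> val H \<beta> (P i) = h i"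
    and gen: "\<And>Q. path en v\<^sub>0 Q v\<^sub>0 \<Longrightarrow> letters Q \<subseteq> letters W \<Longrightarrow>
        \<exists>J. letters J \<subseteq> {1..g} \<and> Q \<sim> subst_word P J"
    and leaf: "\<And>e t. e \<in> letters W \<Longrightarrow> en e t \<noteq> v\<^sub>0 \<Longrightarrow>
        \<exists>l l'. fst l \<in> letters W \<and> fst l' \<in> letters W \<and> start en l = en e t \<and> start en l' = en e t \<and>
           (\<beta> (fst l), snd l) \<noteq> (\<beta> (fst l'), snd l')"
    using c unfolding carries_def by blast+
  define en' where "en' = (\<lambda>e t. r (en e t))"
  define W' where "W' = rename f (p @ q)"
  define P' where "P' = (\<lambda>i. rename f (P i))"
  have lW: "letters W = letters (p @ q)"
    unfolding W using quadratic_fold(2)[of p z s y "\<not> s" q] quad W zy(1) by simp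
  have zyW: "z \<in> letters W" "y \<in> letters W" by (simp_all add: W)
  have lW': "letters W' = f ` letters W" by (simp only: W'_def letters_rename lW)
  have lW'W: "letters W' \<subseteq> letters W" using zyW unfolding lW' by (auto simp: f_def)
  have mid: "en z s = en y s" using path by (auto simp: W path_append)
  have enf: "en' (f e) t = r (en e t)" for e t
  proof (cases "e = y")
    case True
    then show ?thesis using mid by (cases "t = s") (auto simp: en'_def f_def r_def)
  qed (simp add: en'_def f_def)
  have \<beta>f: "\<beta> (f e) = \<beta> e" for e using zy(2) by (simp add: f_def)
  have pathf: "path en' (r u) (rename f Q) (r v)" if "path en u Q v" for u Q v
    using that enf by (rule path_map)
  have "path en' (r v\<^sub>0) W' (r v\<^sub>0)"
  proof -
    obtain m m' where m: "path en v\<^sub>0 p m" "m = en z (\<not> s)" "path en m' q v\<^sub>0" "m' = en y (\<not> s)"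
      using path by (auto simp: W path_append)
    have "r m = r m'" using m by (simp add: r_def)
    then show ?thesis using pathf[OF m(1)] pathf[OF m(3)] by (auto simp: W'_def path_append)
  qed
  moreover have "quadratic W'"
    unfolding W'_def f_def using quadratic_fold(1)[of p z s y "\<not> s" q] quad W zy(1) by simp
  moreover have "\<beta> ` letters W' \<subseteq> B" using \<beta>W lW'W by blast
  moreover have "val H \<beta> W' = T" using val fold_val[OF \<beta> zy(2)] unfolding W'_def f_def W by simp
  moreover have "W' \<sim> sqprod P' g"
    using WP unfolding W'_def P'_def f_def W by (rule fold_feq)
  moreover have "path en' (r v\<^sub>0) (P' i) (r v\<^sub>0) \<and> letters (P' i) \<subseteq> letters W' \<and> val H \<beta> (P' i) = h i"
    if "i \<in> {1..g}" for i
    using pathf[OF P(1)[OF that]] P(2,3)[OF that] by (auto simp: P'_def lW' val_rename \<beta>f)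
  moreover have "\<exists>J. letters J \<subseteq> {1..g} \<and> Q' \<sim> subst_word P' J"
    if Q': "path en' (r v\<^sub>0) Q' (r v\<^sub>0)" "letters Q' \<subseteq> letters W'" for Q'
  proof -
    \<comment> \<open>So \<open>Q'\<close> is unchanged by the renaming and can be compared with the
      image of its lift.\<close>
    have "y \<notin> letters Q'" using zy(1) Q'(2) unfolding lW' by (auto simp: f_def)
    then have "rename f Q' = Q'"
      unfolding rename_def f_def letters_def by (intro map_idI) (force simp: image_iff)
    moreover obtain Q where Q: "path en v\<^sub>0 Q v\<^sub>0" "letters Q \<subseteq> letters Q' \<union> {z, y}" "rename f Q \<sim> rename f Q'"
      using fold_path_lift[of en z s y r v\<^sub>0 Q' v\<^sub>0] mid Q'(1) unfolding en'_def f_def r_def by blast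
    moreover have "letters Q \<subseteq> letters W" using Q(2) Q'(2) lW'W zyW by auto
    then obtain J where J: "letters J \<subseteq> {1..g}" "Q \<sim> subst_word P J" using gen[OF Q(1)] by blast
    moreover have "rename f Q \<sim> subst_word P' J"
      using feq_rename[OF J(2), of f] by (simp only: rename_subst_word P'_def)
    ultimately show ?thesis by (metis feq_sym feq_trans)
  qed
  moreover have "\<exists>l l'. fst l \<in> letters W' \<and> fst l' \<in> letters W' \<and> start en' l = en' e' t \<and>
      start en' l' = en' e' t \<and> (\<beta> (fst l), snd l) \<noteq> (\<beta> (fst l'), snd l')"
    if "e' \<in> letters W'" "en' e' t \<noteq> r v\<^sub>0" for e' t
  proof -
    have "e' \<in> letters W" "en e' t \<noteq> v\<^sub>0" using that lW'W by (auto simp: en'_def)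
    then obtain l l' where l: "fst l \<in> letters W" "fst l' \<in> letters W" "start en l = en e' t"
      "start en l' = en e' t" "(\<beta> (fst l), snd l) \<noteq> (\<beta> (fst l'), snd l')" using leaf by blast
    moreover have "en' e' t = r (en e' t)" by (simp add: en'_def)
    ultimately show ?thesis
      by (intro exI[of _ "(f (fst l'), snd l')", THEN exI[of _ "(f (fst l), snd l)"]])
        (auto simp: lW' enf \<beta>f)
  qed
  ultimately show ?thesis unfolding carries_def en'_def[symmetric] W'_def[symmetric] P'_def[symmetric] by blast
qed

text \<open>An edge traversed by \<open>W\<close> back and forth would be a bridge, since no closed path crosses it an
  odd number of times, and its far end would be a leaf.\<close>

lemma carries_no_spur:
  fixes en :: "'z \<Rightarrow> bool \<Rightarrow> 'v"
  assumes c: "carries \<beta> h en v\<^sub>0 W P" and \<beta>: "range \<beta> \<subseteq> carrier H"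
    and W: "W = p @ (z, s) # (z, \<not> s) # q"
  shows False
proof -
  have quad: "quadratic W" and path: "path en v\<^sub>0 W v\<^sub>0" and \<beta>W: "\<beta> ` letters W \<subseteq> B" and val: "val H \<beta> W = T"
    and WP: "W \<sim> sqprod P g"
    and gen: "\<And>Q. path en v\<^sub>0 Q v\<^sub>0 \<Longrightarrow> letters Q \<subseteq> letters W \<Longrightarrow>
        \<exists>J. letters J \<subseteq> {1..g} \<and> Q \<sim> subst_word P J"
    and leaf: "\<And>e t. e \<in> letters W \<Longrightarrow> en e t \<noteq> v\<^sub>0 \<Longrightarrow>
        \<exists>l l'. fst l \<in> letters W \<and> fst l' \<in> letters W \<and> start en l = en e t \<and> start en l' = en e t \<and>
           (\<beta> (fst l), snd l) \<noteq> (\<beta> (fst l'), snd l')"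
    using c unfolding carries_def by blast+
  have zpq: "z \<notin> letters (p @ q)" using quadratic_spur(2)[of p z s "\<not> s" q] quad W by simp
  have ind: "independent g P" by (rule independent_if_value[OF quad \<beta> \<beta>W val WP])
  have "p @ q \<sim> W" using feq_sym[OF feq_cancel[of p z s q]] W by simp
  then have "mag z x W = 0" for x
    using mag_feq[of "p @ q" W z x] zpq mag_notin[of z "p @ q" x] by simp
  then have zero: "(\<Sum>k=1..g. cnt z (P k) * cnt x (P k)) = 0" for x
    using mag_feq[OF WP, of z x] by (simp only: mag_sqprod)
  \<comment> \<open>The vector of \<open>z\<close> pairs to zero with every letter, so it is itself
    a linear relation among the independent \<open>P k\<close>.\<close>
  then have cP: "cnt z (P k) = 0" if "k \<in> {1..g}" for k
    using spec[OF ind[unfolded independent_def], of "\<lambda>k. cnt z (P k)"] zero that by blast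
  have cQ: "cnt z Q = 0" if Q: "path en v\<^sub>0 Q v\<^sub>0" "letters Q \<subseteq> letters W" for Q
  proof -
    obtain J where J: "letters J \<subseteq> {1..g}" "Q \<sim> subst_word P J" using gen[OF Q] by blast
    have "cnt z (subst_word P J) = 0" using J(1) cP by (induction J) auto
    then show ?thesis using cnt_feq[OF J(2)] by simp
  qed
  define m where "m = en z s"
  have p: "path en v\<^sub>0 p (en z (\<not> s))" and q: "path en (en z (\<not> s)) q v\<^sub>0"
    using path by (auto simp: W path_append)
  \<comment> \<open>A path to the far end of \<open>z\<close> that avoids \<open>z\<close> would
    close up, through \<open>z\<close> and back along \<open>p\<close>, to a closed path crossing
    \<open>z\<close> once.\<close>
  have sep: False if R: "path en v\<^sub>0 R m" "letters R \<subseteq> letters (p @ q)" for R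
  proof -
    define Q where "Q = R @ [(z, \<not> s)] @ winv p"
    have "path en v\<^sub>0 Q v\<^sub>0" using R(1) path_winv[OF p] by (auto simp: Q_def path_append m_def)
    moreover have "letters Q \<subseteq> letters W" using R(2) by (auto simp: Q_def W)
    ultimately have "cnt z Q = 0" by (rule cQ)
    moreover have "cnt z R = 0" "cnt z p = 0" using R(2) zpq by (auto intro!: cnt_notin)
    ultimately show False by (simp add: Q_def)
  qed
  \<comment> \<open>Any other edge lies on \<open>p\<close> or \<open>q\<close>, whose vertices are
    joined to the base point without using \<open>z\<close>.\<close>
  have only: "fst l = z" if l: "fst l \<in> letters W" "start en l = m" for l
  proof (rule ccontr)
    assume "fst l \<noteq> z"
    then consider "fst l \<in> letters p" | "fst l \<in> letters (winv q)" using l(1) by (auto simp: W)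
    then show False
    proof cases
      case 1
      then obtain R where "path en v\<^sub>0 R (en (fst l) (\<not> snd l))" "letters R \<subseteq> letters p"
        by (rule path_to_end[OF p])
      then show False using sep l(2) by auto
    next
      case 2
      then obtain R where "path en v\<^sub>0 R (en (fst l) (\<not> snd l))" "letters R \<subseteq> letters (winv q)"
        by (rule path_to_end[OF path_winv[OF q]])
      then show False using sep l(2) by auto
    qed
  qed
  have "m \<noteq> v\<^sub>0" using sep[of "[]"] by auto
  moreover have "z \<in> letters W" by (simp add: W)
  ultimately obtain l l' where ll: "fst l \<in> letters W" "fst l' \<in> letters W" "start en l = m"
    "start en l' = m" "(\<beta> (fst l), snd l) \<noteq> (\<beta> (fst l'), snd l')"
    using leaf[of z s] unfolding m_def by metis
  have "fst l = z" "fst l' = z" using only ll(1-4) by blast+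
  with ll have "snd l \<noteq> snd l'" by auto
  \<comment> \<open>Two different directions at \<open>m\<close>, both along \<open>z\<close>, make
    \<open>z\<close> a loop; then \<open>p\<close> already reaches \<open>m\<close> while avoiding
    \<open>z\<close>.\<close>
  then have "en z (\<not> s) = m"
    using ll(3,4) \<open>fst l = z\<close> \<open>fst l' = z\<close> by (cases s; cases "snd l"; cases "snd l'") auto
  then show False using sep[OF _ ] p by auto
qed

text \<open>Each fold shortens \<open>W\<close> by two letters, and a cancelling pair always
  consists of two different edges.\<close>

lemma carries_folded_exists:
  fixes en :: "'z \<Rightarrow> bool \<Rightarrow> 'v"
  assumes "carries \<beta> h en v\<^sub>0 W P" "range \<beta> \<subseteq> carrier H"
  shows "\<exists>(en' :: 'z \<Rightarrow> bool \<Rightarrow> 'v) v\<^sub>0' W' P'. carries \<beta> h en' v\<^sub>0' W' P' \<and> reduced (rename \<beta> W')"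
  using assms(1)
proof (induction "length W" arbitrary: en v\<^sub>0 W P rule: less_induct)
  case less
  show ?case
  proof (cases "reduced (rename \<beta> W)")
    case True
    then show ?thesis using less.prems by blast
  next
    case False
    then obtain p z s y q where W: "W = p @ (z, s) # (y, \<not> s) # q" and \<beta>: "\<beta> z = \<beta> y"
      by (rule not_reduced_labels)
    have "z \<noteq> y" using carries_no_spur[OF less.prems assms(2)] W by blast
    from carries_fold[OF less.prems assms(2) W this \<beta>] show ?thesis
      by (rule less.hyps[rotated]) (simp add: W)
  qed
qed

text \<open>\<open>J i\<close> expresses the circle \<open>P i\<close> in the petals
  \<open>u j\<close>, and \<open>K i\<close> expresses the petal \<open>u i\<close> in the circles.
  So \<open>J\<close> is an endomorphism preserving the product of squares, and \<open>K\<close>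
  witnesses that it is onto.\<close>

lemma folded_solution:
  fixes en :: "'z \<Rightarrow> bool \<Rightarrow> 'v"
  assumes c: "carries \<beta> h en v\<^sub>0 W P" and \<beta>: "range \<beta> \<subseteq> carrier H" and red: "reduced (rename \<beta> W)"
  shows "\<exists>J K. (\<forall>i\<in>{1..g}. letters (J i) \<subseteq> {1..g} \<and> letters (K i) \<subseteq> {1..g} \<and>
      h i = val H (\<lambda>i. a i [^]\<^bsub>H\<^esub> n i) (J i) \<and> [(i, True)] \<sim> subst_word J (K i)) \<and>
    sqprod J g \<sim> sqprod (\<lambda>i. [(i, True)]) g"
proof -
  have quad: "quadratic W" and path: "path en v\<^sub>0 W v\<^sub>0" and \<beta>W: "\<beta> ` letters W \<subseteq> B" and val: "val H \<beta> W = T"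
    and WP: "W \<sim> sqprod P g"
    and P: "\<And>i. i \<in> {1..g} \<Longrightarrow> path en v\<^sub>0 (P i) v\<^sub>0" "\<And>i. i \<in> {1..g} \<Longrightarrow> letters (P i) \<subseteq> letters W"
      "\<And>i. i \<in> {1..g} \<Longrightarrow> val H \<beta> (P i) = h i"
    and gen: "\<And>Q. path en v\<^sub>0 Q v\<^sub>0 \<Longrightarrow> letters Q \<subseteq> letters W \<Longrightarrow>
        \<exists>J. letters J \<subseteq> {1..g} \<and> Q \<sim> subst_word P J"
    using c unfolding carries_def by blast+
  obtain u where W: "W = sqprod u g"
    and dist: "\<And>i. i \<in> {1..g} \<Longrightarrow> distinct (map fst (u i))"
    and lab: "\<And>i. i \<in> {1..g} \<Longrightarrow> rename \<beta> (u i) = replicate (nat \<bar>n i\<bar>) (a i, n i > 0)"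
    and cnt_u: "\<And>i z y k. i \<in> {1..g} \<Longrightarrow> z \<in> letters (u i) \<Longrightarrow> y \<in> letters (u i) \<Longrightarrow> k \<in> {1..g} \<Longrightarrow>
      cnt z (P k) = cnt y (P k)"
    using folded_word_structure(2)[OF quad \<beta>W val red WP] by blast
  have lW: "letters W = (\<Union>i\<in>{1..g}. letters (u i))" by (simp only: W letters_sqprod)
  have len: "length (u i) = nat \<bar>n i\<bar>" if "i \<in> {1..g}" for i
    using arg_cong[OF lab[OF that], of length] by simp
  have u_ne: "u i \<noteq> []" if "i \<in> {1..g}" for i using len[OF that] n0[OF that] by auto
  have pathU: "path en v\<^sub>0 (u i) v\<^sub>0" if "i \<in> {1..g}" for i
  proof -
    have "set [1..<Suc g] = {1..g}" by auto
    then show ?thesis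
      using path_squares[of en v\<^sub>0 u "[1..<Suc g]" v\<^sub>0] path u_ne that unfolding W sqprod_def by blast
  qed
  have disj: "i = j" if "i \<in> {1..g}" "j \<in> {1..g}" "z \<in> letters (u i)" "z \<in> letters (u j)" for i j z
  proof -
    have "\<beta> z = a i" if "i \<in> {1..g}" "z \<in> letters (u i)" for i
    proof -
      have "\<beta> z \<in> letters (rename \<beta> (u i))" using that(2) by simp
      then show ?thesis unfolding lab[OF that(1)] by (auto simp: letters_def)
    qed
    then show ?thesis using that inj_onD[OF inj_a] by metis
  qed
  have cnt_take: "cnt (fst (u i ! q)) (take j (u i')) = of_bool (i = i' \<and> q < j)"
    if i: "i \<in> {1..g}" "i' \<in> {1..g}" and q: "q < length (u i)" for i i' q j
  proof -
    have in_iff: "fst (u i ! q) \<in> letters (take j (u i')) \<longleftrightarrow> i = i' \<and> q < j"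
    proof
      assume l: "fst (u i ! q) \<in> letters (take j (u i'))"
      have "fst (u i ! q) \<in> letters (u i)" using q by (simp add: letters_def)
      moreover have "fst (u i ! q) \<in> letters (u i')" using l by (auto simp: letters_def dest: in_set_takeD)
      ultimately have "i = i'" by (rule disj[OF i])
      moreover obtain q' where "q' < j" "q' < length (u i')" "fst (u i ! q) = fst (u i' ! q')"
        using l by (auto simp: letters_def in_set_conv_nth)
      ultimately show "i = i' \<and> q < j"
        using dist[OF i(1)] q nth_eq_iff_index_eq[of "map fst (u i)" q q'] by auto
    next
      assume "i = i' \<and> q < j"
      then show "fst (u i ! q) \<in> letters (take j (u i'))"
        using q unfolding letters_def by (auto simp: in_set_conv_nth intro!: image_eqI[of _ _ "u i ! q"] exI[of _ q])
    qed
    have occ_le: "occ z w \<le> 1" if "distinct (map fst w)" for z and w :: "'z word"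
      using that by (induction w) (auto simp: occ_eq_0_iff letters_def le_Suc_eq)
    have "distinct (map fst (take j (u i')))" using dist[OF i(2)] by (simp flip: take_map)
    then have "occ (fst (u i ! q)) (take j (u i')) \<le> 1" by (rule occ_le)
    then show ?thesis
      using in_iff occ_eq_0_iff[of "fst (u i ! q)" "take j (u i')"]
      by (cases "i = i' \<and> q < j") (auto simp: cnt_eq_occ le_Suc_eq)
  qed
  have cnt_closed: "cnt z Q = cnt y Q"
    if zy: "path en v\<^sub>0 Q v\<^sub>0" "letters Q \<subseteq> letters W" "i \<in> {1..g}" "z \<in> letters (u i)" "y \<in> letters (u i)"
    for Q i z y
  proof -
    obtain J where J: "letters J \<subseteq> {1..g}" "Q \<sim> subst_word P J" using gen[OF zy(1,2)] by blast
    have "cnt z (subst_word P J) = cnt y (subst_word P J)"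
      using J(1) cnt_u[OF zy(3-5)] by (intro cnt_subst_word) auto
    then show ?thesis using cnt_feq[OF J(2)] by simp
  qed
  \<comment> \<open>If two petals meet, running along one and back along the other gives a closed
    path. By \<open>cnt_closed\<close> it crosses all edges of one petal with the same parity.
    Comparing the edges at \<open>j\<close> and \<open>j'\<close>, or at \<open>0\<close> and
    \<open>j\<close>, forces equal positions on one petal, and the base point on two different
    ones.\<close>
  have sep: "take j (u i) = take j' (u i')"
    if i: "i \<in> {1..g}" "i' \<in> {1..g}" and j: "j < length (u i)" "j' < length (u i')"
      and st: "start en (u i ! j) = start en (u i' ! j')" for i j i' j'
  proof -
    define Q where "Q = take j (u i) @ winv (take j' (u i'))"
    have "path en v\<^sub>0 Q v\<^sub>0"
      using path_take[OF pathU[OF i(1)] j(1)] path_winv[OF path_take[OF pathU[OF i(2)] j(2)]] st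
      by (auto simp: Q_def path_append)
    moreover have "letters Q \<subseteq> letters W"
    proof -
      have "letters (take k w) \<subseteq> letters w" for k and w :: "'z word"
        by (auto simp: letters_def dest: in_set_takeD)
      then show ?thesis using i unfolding lW Q_def by fastforce
    qed
    ultimately have Q: "cnt (fst (u k ! q)) Q = cnt (fst (u k ! q')) Q"
      if "k \<in> {1..g}" "q < length (u k)" "q' < length (u k)" for k q q'
      using cnt_closed[of Q k] that by (simp add: letters_def)
    have cntQ: "cnt (fst (u k ! q)) Q = of_bool (k = i \<and> q < j) + of_bool (k = i' \<and> q < j')"
      if "k \<in> {1..g}" "q < length (u k)" for k q
      using cnt_take[OF that(1) i(1) that(2)] cnt_take[OF that(1) i(2) that(2)] by (simp add: Q_def)
    show ?thesis
    proof (cases "i = i'")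
      case True
      have "j = j'"
        using Q[OF i(1), of j j'] j True i by (cases j j' rule: linorder_cases) (simp_all add: cntQ)
      then show ?thesis using True by simp
    next
      case False
      have l: "0 < length (u i)" "0 < length (u i')" using j by auto
      have "j = 0"
        using Q[OF i(1) l(1) j(1)] cntQ[OF i(1) l(1)] cntQ[OF i(1) j(1)] False by (cases "j = 0") simp_all
      moreover have "j' = 0"
        using Q[OF i(2) l(2) j(2)] cntQ[OF i(2) l(2)] cntQ[OF i(2) j(2)] False by (cases "j' = 0") simp_all
      ultimately show ?thesis by simp
    qed
  qed
  have "\<exists>J. letters J \<subseteq> {1..g} \<and> P i \<sim> subst_word u J" if "i \<in> {1..g}" for i
    using P(1,2)[OF that] unfolding lW by (intro closed_path_feq_petals[where en = en and v\<^sub>0 = v\<^sub>0] pathU sep)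
  then obtain J where J: "\<And>i. i \<in> {1..g} \<Longrightarrow> letters (J i) \<subseteq> {1..g}" "\<And>i. i \<in> {1..g} \<Longrightarrow> P i \<sim> subst_word u (J i)"
    by metis
  have "\<exists>K. letters K \<subseteq> {1..g} \<and> u i \<sim> subst_word P K" if "i \<in> {1..g}" for i
    using that by (intro gen pathU) (auto simp: lW)
  then obtain K where K: "\<And>i. i \<in> {1..g} \<Longrightarrow> letters (K i) \<subseteq> {1..g}" "\<And>i. i \<in> {1..g} \<Longrightarrow> u i \<sim> subst_word P (K i)"
    by metis
  \<comment> \<open>Collapses every petal to its first edge, read as the letter \<open>i\<close>;
    taking over the sign of that edge makes \<open>u i\<close> map to \<open>i\<close> itself, not
    to its inverse.\<close>
  define \<kappa> where "\<kappa> = (\<lambda>e. if \<exists>i\<in>{1..g}. e = fst (hd (u i))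
    then (let i = SOME i. i \<in> {1..g} \<and> e = fst (hd (u i)) in [(i, snd (hd (u i)))]) else [])"
  have \<kappa>u: "subst_word \<kappa> (u i) = [(i, True)]" if i: "i \<in> {1..g}" for i
  proof -
    obtain l w where lw: "u i = l # w" using u_ne[OF i] by (cases "u i") auto
    have hd_in: "fst (hd (u j)) \<in> letters (u j)" if "j \<in> {1..g}" for j
      using u_ne[OF that] by (simp add: letters_def)
    have some: "j = i" if "j \<in> {1..g} \<and> fst l = fst (hd (u j))" for j
      using disj[OF _ i, of j "fst l"] that hd_in[of j] by (auto simp: lw)
    have "(SOME j. j \<in> {1..g} \<and> fst l = fst (hd (u j))) = i"
      by (rule some_equality) (use i lw some in auto)
    moreover have "\<exists>j\<in>{1..g}. fst l = fst (hd (u j))" using i lw by (intro bexI[of _ i]) auto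
    ultimately have "\<kappa> (fst l) = [(i, snd (hd (u i)))]" by (simp only: \<kappa>_def if_True Let_def)
    then have "\<kappa> (fst l) = [(i, snd l)]" by (simp add: lw)
    moreover have "\<kappa> e = []" if e: "e \<in> letters w" for e
    proof -
      have "e \<noteq> fst (hd (u j))" if j: "j \<in> {1..g}" for j
      proof
        assume eq: "e = fst (hd (u j))"
        then have "j = i" using disj[OF j i, of e] hd_in[OF j] e lw by auto
        then show False using eq e lw dist[OF i] by (auto simp: letters_def)
      qed
      then show ?thesis by (auto simp: \<kappa>_def)
    qed
    then have "subst_word \<kappa> w = []" by (rule subst_word_empty)
    ultimately show ?thesis by (simp add: lw)
  qed
  \<comment> \<open>Thus \<open>\<kappa>\<close> turns paths back into words in the petals, and
    every relation below is obtained by applying it.\<close>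
  have \<kappa>P: "subst_word \<kappa> (P i) \<sim> J i" if "i \<in> {1..g}" for i
  proof -
    have "subst_word \<kappa> (subst_word u (J i)) = J i"
      unfolding subst_word_subst_word using \<kappa>u J(1)[OF that] by (intro subst_word_id) auto
    then show ?thesis using feq_subst_word[OF J(2)[OF that], of \<kappa>] by simp
  qed
  have "h i = val H (\<lambda>i. a i [^]\<^bsub>H\<^esub> n i) (J i)" if i: "i \<in> {1..g}" for i
  proof -
    have cl: "\<beta> ` letters w \<subseteq> carrier H" for w using \<beta> by blast
    have "val H \<beta> (u j) = a j [^]\<^bsub>H\<^esub> n j" if "j \<in> {1..g}" for j
    proof -
      have "val H \<beta> (u j) = val H (\<lambda>b. b) (rename \<beta> (u j))" by (simp add: val_rename)
      then show ?thesis
        using val_replicate_int[of "\<lambda>b. b" "a j" "n j"] a_carrier[OF that] by (simp add: lab[OF that])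
    qed
    then have "val H (\<lambda>j. val H \<beta> (u j)) (J i) = val H (\<lambda>i. a i [^]\<^bsub>H\<^esub> n i) (J i)"
      using J(1)[OF i] by (intro val_cong) auto
    moreover have "h i = val H (\<lambda>j. val H \<beta> (u j)) (J i)"
      using P(3)[OF i] val_feq[OF J(2)[OF i] \<beta>] val_subst_word[of \<beta> u "J i", OF cl] by simp
    ultimately show ?thesis by simp
  qed
  moreover have "[(i, True)] \<sim> subst_word J (K i)" if i: "i \<in> {1..g}" for i
  proof -
    have "[(i, True)] \<sim> subst_word (\<lambda>j. subst_word \<kappa> (P j)) (K i)"
      using feq_subst_word[OF K(2)[OF i], of \<kappa>] by (simp add: \<kappa>u[OF i] subst_word_subst_word)
    also have "\<dots> \<sim> subst_word J (K i)"
      using \<kappa>P K(1)[OF i] by (intro feq_subst_word_cong) auto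
    finally show ?thesis .
  qed
  moreover have "sqprod J g \<sim> sqprod (\<lambda>i. [(i, True)]) g"
  proof -
    have "sqprod J g \<sim> sqprod (\<lambda>i. subst_word \<kappa> (P i)) g"
      by (intro feq_sqprod feq_sym[OF \<kappa>P])
    also have "\<dots> \<sim> subst_word \<kappa> W"
      using feq_subst_word[OF feq_sym[OF WP], of \<kappa>] by (simp add: subst_word_sqprod)
    also have "\<dots> \<sim> sqprod (\<lambda>i. [(i, True)]) g"
      unfolding W subst_word_sqprod by (intro feq_sqprod) (simp add: \<kappa>u)
    finally show ?thesis .
  qed
  ultimately show ?thesis using J(1) K(1) by blast
qed

end

section \<open>Existence of a carrying graph\<close>

lemma occ_sqprod: "occ z (sqprod P g) = (\<Sum>i=1..g. 2 * occ z (P i))"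
  by (induction g) (simp_all add: sqprod_Suc, simp_all add: sqprod_def)

lemma (in group) val_sqprod:
  assumes "\<And>i. i \<in> {1..g} \<Longrightarrow> f ` letters (P i) \<subseteq> carrier G"
  shows "val G f (sqprod P g) = prod_squares G (\<lambda>i. val G f (P i)) g"
proof -
  have "val G f (concat (map (\<lambda>i. P i @ P i) is)) =
      foldr (\<lambda>i r. val G f (P i) [^] (2::nat) \<otimes> r) is \<one>" if "set is \<subseteq> {1..g}" for "is"
    using that
  proof (induction "is")
    case (Cons i "is")
    have c: "f ` letters (P i) \<subseteq> carrier G" "val G f (P i) \<in> carrier G" using assms Cons(2) by auto
    have r: "f ` letters (concat (map (\<lambda>i. P i @ P i) is)) \<subseteq> carrier G"
      using assms Cons(2) by fastforce
    then have "f ` letters (P i @ concat (map (\<lambda>i. P i @ P i) is)) \<subseteq> carrier G"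
      using c by (simp add: image_Un)
    then have "val G f (P i @ P i @ concat (map (\<lambda>i. P i @ P i) is)) =
        val G f (P i) \<otimes> (val G f (P i) \<otimes> val G f (concat (map (\<lambda>i. P i @ P i) is)))"
      using c(1) r by (simp only: val_append)
    also have "\<dots> = val G f (P i) [^] (2::nat) \<otimes> val G f (concat (map (\<lambda>i. P i @ P i) is))"
      using c(2) val_closed[OF r] by (simp add: numeral_2_eq_2 m_assoc)
    finally show ?case using Cons by simp
  qed simp
  from this[of "[1..<Suc g]"] show ?thesis
    unfolding sqprod_def prod_squares_def ordered_prod_def
    by (simp add: atLeastLessThanSuc_atLeastAtMost del: upt_Suc)
qed

lemma ordered_prod_cong:
  "(\<And>i. i \<in> {1..g} \<Longrightarrow> f i = f' i) \<Longrightarrow> ordered_prod G f g = ordered_prod G f' g"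
  unfolding ordered_prod_def by (intro foldr_cong) (auto simp del: upt_Suc)

context square_target
begin

text \<open>The graph is a bouquet of \<open>g\<close> circles, the \<open>i\<close>-th one subdivided according to the reduced
  word \<open>y i\<close> for \<open>h i\<close>.\<close>

lemma carries_exists:
  assumes h: "\<And>i. i \<in> {1..g} \<Longrightarrow> h i \<in> carrier H" and T: "prod_squares H h g = T"
  shows "\<exists>(\<beta> :: nat \<times> nat \<Rightarrow> 'h) (en :: nat \<times> nat \<Rightarrow> bool \<Rightarrow> nat \<times> nat) v\<^sub>0 W P.
    range \<beta> \<subseteq> carrier H \<and> carries \<beta> h en v\<^sub>0 W P"
proof -
  have "\<exists>w. w \<in> reduced_words B \<and> word_value H w = h i" if "i \<in> {1..g}" for i
    using free_basis_word_exists[OF H h[OF that]] by metis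
  then obtain y where y: "\<And>i. i \<in> {1..g} \<Longrightarrow> y i \<in> reduced_words B"
    "\<And>i. i \<in> {1..g} \<Longrightarrow> word_value H (y i) = h i" by metis
  define P where "P = (\<lambda>i. map (\<lambda>j. ((i, j), snd (y i ! j))) [0..<length (y i)])"
  define \<beta> where "\<beta> = (\<lambda>(i, j). if i \<in> {1..g} \<and> j < length (y i) then fst (y i ! j) else \<one>\<^bsub>H\<^esub>)"
  \<comment> \<open>The vertex in front of the \<open>j\<close>-th letter of circle
    \<open>i\<close>. Circles are numbered from 1, so the base point \<open>(0, 0)\<close> differs
    from all inner vertices.\<close>
  define vt where "vt = (\<lambda>i j. if j = 0 \<or> j = length (y i) then (0, 0) else (i, j))"
  \<comment> \<open>Edges are oriented along their basis labels, so \<open>P i\<close> crosses edge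
    \<open>(i, j)\<close> forwards or backwards according to the sign of that letter.\<close>
  define en where "en = (\<lambda>(i, j) t. if t = snd (y i ! j) then vt i (Suc j) else vt i j)"
  have lenP: "length (P i) = length (y i)" for i by (simp add: P_def)
  have nthP: "P i ! j = ((i, j), snd (y i ! j))" if "j < length (y i)" for i j
    using that by (simp add: P_def)
  have startP: "start en (P i ! j) = vt i j" and finishP: "finish en (P i ! j) = vt i (Suc j)"
    if "j < length (y i)" for i j
    using that by (simp_all add: nthP en_def)
  have lP: "letters (P i) = {(i, j) | j. j < length (y i)}" for i
    by (auto simp: P_def letters_def image_iff)
  have vt0: "vt i 0 = (0, 0)" "vt i (length (y i)) = (0, 0)" for i by (simp_all add: vt_def)
  have path: "path en (0, 0) (P i) (0, 0)" for i
    using path_if_vertices[of "P i" en "vt i"] startP finishP by (simp add: lenP vt0)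
  define W where "W = sqprod P g"
  have lW: "letters W = (\<Union>i\<in>{1..g}. letters (P i))" by (simp only: W_def letters_sqprod)
  have y_in: "fst (y i ! j) \<in> B" if "i \<in> {1..g}" "j < length (y i)" for i j
    using y(1)[OF that(1)] that(2) by (auto simp: reduced_words_iff letters_def)
  have \<beta>W: "\<beta> ` letters W \<subseteq> B" using y_in by (auto simp: lW lP \<beta>_def)
  have \<beta>: "range \<beta> \<subseteq> carrier H" using subsetD[OF B_carrier y_in] by (auto simp: \<beta>_def)
  have "rename \<beta> (P i) = y i" if "i \<in> {1..g}" for i
    using that by (intro nth_equalityI) (simp_all add: lenP rename_def nthP \<beta>_def)
  then have valP: "val H \<beta> (P i) = h i" if "i \<in> {1..g}" for i
    using y(2)[OF that] that val_rename[of H "\<lambda>b. b" \<beta> "P i"] by (simp add: word_value_eq_val)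
  have "prod_squares H (\<lambda>i. val H \<beta> (P i)) g = prod_squares H h g"
    unfolding prod_squares_def using valP by (intro ordered_prod_cong) simp
  moreover have "\<beta> ` letters w \<subseteq> carrier H" for w using \<beta> by blast
  ultimately have valW: "val H \<beta> W = T"
    using T val_sqprod[of g \<beta> P] by (simp add: W_def)
  have quad: "quadratic W"
    unfolding quadratic_def
  proof
    fix z assume "z \<in> letters W"
    then obtain i j where z: "z = (i, j)" "i \<in> {1..g}" "j < length (y i)" by (auto simp: lW lP)
    have "occ z (P i) = 1"
    proof -
      have "filter (\<lambda>j'. j' = j) [0..<m] = (if j < m then [j] else [])" for m by (induction m) auto
      then show ?thesis using z by (simp add: occ_def P_def filter_map comp_def)
    qed
    moreover have "occ z (P k) = 0" if "k \<noteq> i" for k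
      using that z(1) by (simp only: occ_eq_0_iff lP) auto
    ultimately have "(\<Sum>k=1..g. 2 * occ z (P k)) = (\<Sum>k=1..g. if k = i then 2 else 0)"
      by (intro sum.cong) auto
    then show "occ z W = 2" using z(2) by (simp add: W_def occ_sqprod)
  qed
  have pathW: "path en (0, 0) W (0, 0)"
  proof -
    have "path en (0, 0) (concat (map (\<lambda>i. P i @ P i) is)) (0, 0)" for "is"
    proof (induction "is")
      case (Cons i "is")
      then show ?case unfolding list.map concat.simps path_append using path[of i] by blast
    qed simp
    then show ?thesis by (simp only: W_def sqprod_def)
  qed
  have gen: "\<exists>J. letters J \<subseteq> {1..g} \<and> Q \<sim> subst_word P J"
    if "path en (0, 0) Q (0, 0)" "letters Q \<subseteq> letters W" for Q
  proof (rule closed_path_feq_petals[OF path _ that(1) that(2)[unfolded lW]])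
    fix i j i' j'
    assume "i \<in> {1..g}" "i' \<in> {1..g}" "j < length (P i)" "j' < length (P i')"
      "start en (P i ! j) = start en (P i' ! j')"
    then have "vt i j = vt i' j'" "j < length (y i)" "j' < length (y i')" "i \<noteq> 0" "i' \<noteq> 0"
      by (auto simp: lenP startP)
    then show "take j (P i) = take j' (P i')" by (auto simp: vt_def split: if_splits)
  qed
  have leaf: "\<exists>l l'. fst l \<in> letters W \<and> fst l' \<in> letters W \<and> start en l = en e t \<and> start en l' = en e t \<and>
      (\<beta> (fst l), snd l) \<noteq> (\<beta> (fst l'), snd l')"
    if e: "e \<in> letters W" "en e t \<noteq> (0, 0)" for e t
  proof -
    obtain i j where ij: "e = (i, j)" "i \<in> {1..g}" "j < length (y i)" using e(1) by (auto simp: lW lP)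
    \<comment> \<open>An inner vertex lies between letters \<open>q\<close> and
      \<open>Suc q\<close>. The direction onwards and the direction back differ in label or sign
      because \<open>y i\<close> is reduced.\<close>
    obtain q where q: "en e t = vt i (Suc q)" "Suc q < length (y i)"
    proof (cases "t = snd (y i ! j)")
      case True
      then have "en e t = vt i (Suc j)" by (simp add: en_def ij)
      moreover from this have "Suc j < length (y i)"
        using e(2) ij(3) by (cases "Suc j = length (y i)") (auto simp: vt_def)
      ultimately show ?thesis by (rule that)
    next
      case False
      then have *: "en e t = vt i j" by (simp add: en_def ij)
      then have "j \<noteq> 0" using e(2) by (cases "j = 0") (auto simp: vt_def)
      then show ?thesis using that[of "j - 1"] * ij(3) by simp
    qed
    define l where "l = P i ! Suc q"
    define l' where "l' = (fst (P i ! q), \<not> snd (P i ! q))"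
    have "fst l \<in> letters W" "fst l' \<in> letters W"
      using q(2) ij(2) by (auto simp: lW lP l_def l'_def nthP)
    moreover have "start en l = en e t" using q startP by (simp add: l_def)
    moreover have "start en l' = en e t" using q finishP[of q i] by (simp add: l'_def)
    moreover have "(\<beta> (fst l), snd l) \<noteq> (\<beta> (fst l'), snd l')"
    proof -
      have "reduced (y i)" using y(1)[OF ij(2)] by (simp add: reduced_words_iff)
      then have "\<not> (fst (y i ! q) = fst (y i ! Suc q) \<and> snd (y i ! q) \<noteq> snd (y i ! Suc q))"
        using q(2) unfolding reduced_def successively_nth_iff by (auto simp: case_prod_beta)
      then show ?thesis using q(2) ij(2) by (auto simp: l_def l'_def nthP \<beta>_def)
    qed
    ultimately show ?thesis by blast
  qed
  have lPW: "letters (P i) \<subseteq> letters W" if "i \<in> {1..g}" for i using that unfolding lW by blast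
  have "W \<sim> sqprod P g" unfolding W_def by (rule feq_refl)
  then have "carries \<beta> h en (0, 0) W P"
    unfolding carries_def using quad pathW \<beta>W valW path lPW valP gen leaf by blast
  then show ?thesis using \<beta> by blast
qed

theorem solution_words:
  assumes "\<And>i. i \<in> {1..g} \<Longrightarrow> h i \<in> carrier H" "prod_squares H h g = T"
  shows "\<exists>J K. (\<forall>i\<in>{1..g}. letters (J i) \<subseteq> {1..g} \<and> letters (K i) \<subseteq> {1..g} \<and>
      h i = val H (\<lambda>i. a i [^]\<^bsub>H\<^esub> n i) (J i) \<and> [(i, True)] \<sim> subst_word J (K i)) \<and>
    sqprod J g \<sim> sqprod (\<lambda>i. [(i, True)]) g"
proof -
  obtain \<beta> :: "nat \<times> nat \<Rightarrow> 'h" and en :: "nat \<times> nat \<Rightarrow> bool \<Rightarrow> nat \<times> nat" and v\<^sub>0 W P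
    where \<beta>: "range \<beta> \<subseteq> carrier H" and c: "carries \<beta> h en v\<^sub>0 W P"
    using carries_exists[OF assms] by blast
  obtain en' :: "nat \<times> nat \<Rightarrow> bool \<Rightarrow> nat \<times> nat" and v\<^sub>0' W' P'
    where "carries \<beta> h en' v\<^sub>0' W' P'" "reduced (rename \<beta> W')"
    using carries_folded_exists[OF c \<beta>] by blast
  from folded_solution[OF this(1) \<beta> this(2)] show ?thesis .
qed

end

section \<open>From words back to homomorphisms\<close>

lemma free_basis_extend_indexed:
  assumes F: "free_basis F (x ` I)" and x: "inj_on x I" and K: "group K"
    and f: "\<And>i. i \<in> I \<Longrightarrow> f i \<in> carrier K"
  shows "\<exists>\<psi>. \<psi> \<in> hom F K \<and> (\<forall>i\<in>I. \<psi> (x i) = f i)"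
proof -
  have xi: "inv_into I x (x i) = i" if "i \<in> I" for i using x that by simp
  have "f (inv_into I x b) \<in> carrier K" if "b \<in> x ` I" for b using that xi f by auto
  then obtain \<psi> where "\<psi> \<in> hom F K" "\<And>b. b \<in> x ` I \<Longrightarrow> \<psi> b = f (inv_into I x b)"
    using free_basis_extend[OF F K, where f = "\<lambda>b. f (inv_into I x b)"] by metis
  then show ?thesis using xi by (intro exI[of _ \<psi>]) auto
qed

theorem theorem4:
  fixes F :: "('f, 'k) monoid_scheme" and H :: "('h, 'm) monoid_scheme"
    and x :: "nat \<Rightarrow> 'f" and a :: "nat \<Rightarrow> 'h" and B :: "'h set"
    and n :: "nat \<Rightarrow> int" and g :: nat
  defines "T \<equiv> ordered_prod H (\<lambda>i. a i [^]\<^bsub>H\<^esub> (2 * n i)) g"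
  assumes "free_basis F (x ` {1..g})" and "inj_on x {1..g}"
    and "free_basis H B"
    and "\<And>i. i \<in> {1..g} \<Longrightarrow> a i \<in> B" and "inj_on a {1..g}"
    and "\<And>i. i \<in> {1..g} \<Longrightarrow> n i \<noteq> 0"
  shows "\<exists>\<phi>\<^sub>0. is_solution F x g H T \<phi>\<^sub>0 \<and>
           (\<forall>i\<in>{1..g}. \<phi>\<^sub>0 (x i) = a i [^]\<^bsub>H\<^esub> n i) \<and>
           (\<forall>\<phi>. is_solution F x g H T \<phi> \<longrightarrow> same_stabilizer_class F x g \<phi>\<^sub>0 \<phi>)"
proof -
  interpret t: square_target H B a n g
    using assms(4-7) by unfold_locales auto
  have T: "T = t.T" by (simp add: T_def t.T_def)
  note F = \<open>free_basis F (x ` {1..g})\<close>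
  interpret F: group F using F by (rule free_basis_imp_group)
  have grp: "group F" "group H" by (rule F.is_group t.is_group)+
  have xF: "x i \<in> carrier F" if "i \<in> {1..g}" for i
    using free_basis_subset[OF F] that by auto
  note extend = free_basis_extend_indexed[OF F \<open>inj_on x {1..g}\<close>]
  obtain \<phi>\<^sub>0 where \<phi>\<^sub>0: "\<phi>\<^sub>0 \<in> hom F H" "\<And>i. i \<in> {1..g} \<Longrightarrow> \<phi>\<^sub>0 (x i) = a i [^]\<^bsub>H\<^esub> n i"
    using extend[OF grp(2), where f = "\<lambda>i. a i [^]\<^bsub>H\<^esub> n i"] t.a_carrier t.int_pow_closed by blast
  have "prod_squares H (\<lambda>i. \<phi>\<^sub>0 (x i)) g = T"
    unfolding prod_squares_def T_def
  proof (rule ordered_prod_cong)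
    fix i assume i: "i \<in> {1..g}"
    have "(a i [^]\<^bsub>H\<^esub> n i) [^]\<^bsub>H\<^esub> (2 :: int) = a i [^]\<^bsub>H\<^esub> (n i * 2)"
      using t.int_pow_pow t.a_carrier[OF i] by blast
    then show "\<phi>\<^sub>0 (x i) [^]\<^bsub>H\<^esub> (2 :: nat) = a i [^]\<^bsub>H\<^esub> (2 * n i)"
      using \<phi>\<^sub>0(2)[OF i] int_pow_int[of H "a i [^]\<^bsub>H\<^esub> n i" 2] by (simp add: mult.commute)
  qed
  with \<phi>\<^sub>0 have sol: "is_solution F x g H T \<phi>\<^sub>0" by (simp add: is_solution_def)
  have "same_stabilizer_class F x g \<phi>\<^sub>0 \<phi>" if \<phi>: "is_solution F x g H T \<phi>" for \<phi>
  proof -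
    have \<phi>_hom: "\<phi> \<in> hom F H" and \<phi>_T: "prod_squares H (\<lambda>i. \<phi> (x i)) g = t.T"
      using \<phi> by (simp_all add: is_solution_def T)
    have \<phi>H: "\<phi> (x i) \<in> carrier H" if "i \<in> {1..g}" for i
      using hom_in_carrier[OF \<phi>_hom xF[OF that]] .
    obtain J K where
      J: "\<And>i. i \<in> {1..g} \<Longrightarrow> letters (J i) \<subseteq> {1..g}" and K: "\<And>i. i \<in> {1..g} \<Longrightarrow> letters (K i) \<subseteq> {1..g}"
      and \<phi>_J: "\<And>i. i \<in> {1..g} \<Longrightarrow> \<phi> (x i) = val H (\<lambda>i. a i [^]\<^bsub>H\<^esub> n i) (J i)"
      and KJ: "\<And>i. i \<in> {1..g} \<Longrightarrow> [(i, True)] \<sim> subst_word J (K i)"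
      and sq: "sqprod J g \<sim> sqprod (\<lambda>i. [(i, True)]) g"
      using t.solution_words[where h = "\<lambda>i. \<phi> (x i)", OF \<phi>H \<phi>_T] by blast
    \<comment> \<open>A default off \<open>{1..g}\<close> supplies values in the carrier on all
      letters, as invariance under free equivalence demands.\<close>
    define x' where "x' = (\<lambda>i. if i \<in> {1..g} then x i else \<one>\<^bsub>F\<^esub>)"
    have x': "range x' \<subseteq> carrier F" using xF by (auto simp: x'_def)
    have x'c: "x' ` letters w \<subseteq> carrier F" for w using x' by blast
    \<comment> \<open>\<open>\<phi>\<^sub>0\<close> sends \<open>x j\<close> to the value of the
      petal \<open>u j\<close>, so reading \<open>J i\<close> in the \<open>x j\<close> gives an
      element that \<open>\<phi>\<^sub>0\<close> maps to \<open>\<phi> (x i)\<close>.\<close>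
    define q where "q = (\<lambda>i. val F x' (J i))"
    have q: "q i \<in> carrier F" for i unfolding q_def by (rule F.val_closed) (rule x'c)
    obtain \<sigma> where \<sigma>: "\<sigma> \<in> hom F F" "\<And>i. i \<in> {1..g} \<Longrightarrow> \<sigma> (x i) = q i"
      using extend[OF grp(1), where f = q] q by blast
    have \<sigma>_val: "\<sigma> (val F x' w) = val F q w" if "letters w \<subseteq> {1..g}" for w
      unfolding hom_val[OF grp(1,1) \<sigma>(1) x'c] using that \<sigma>(2) by (intro val_cong) (auto simp: x'_def)
    have x_val: "x i = \<sigma> (val F x' (K i))" if "i \<in> {1..g}" for i
    proof -
      have "val F x' [(i, True)] = val F x' (subst_word J (K i))"
        by (rule F.val_feq[OF KJ[OF that] x'])
      also have "\<dots> = val F q (K i)" unfolding q_def by (rule F.val_subst_word) (rule x'c)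
      finally show ?thesis using \<sigma>_val[OF K[OF that]] that xF by (simp add: x'_def)
    qed
    have surj: "\<sigma> ` carrier F = carrier F"
    proof
      show "\<sigma> ` carrier F \<subseteq> carrier F" using \<sigma>(1) by (auto simp: hom_def)
      \<comment> \<open>The words \<open>K i\<close> define a right inverse of
        \<open>\<sigma>\<close>.\<close>
      obtain \<tau> where \<tau>: "\<tau> \<in> hom F F" "\<And>i. i \<in> {1..g} \<Longrightarrow> \<tau> (x i) = val F x' (K i)"
        using extend[OF grp(1), where f = "\<lambda>i. val F x' (K i)"] F.val_closed[OF x'c] by blast
      have comp: "(\<lambda>w. \<sigma> (\<tau> w)) \<in> hom F F" using hom_compose[OF \<tau>(1) \<sigma>(1)] by (simp add: comp_def)
      have id: "(\<lambda>w. w) \<in> hom F F" by (simp add: hom_def)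
      have "\<sigma> (\<tau> b) = b" if "b \<in> x ` {1..g}" for b
        using that \<tau>(2) x_val by auto
      then have "\<sigma> (\<tau> w) = w" if "w \<in> carrier F" for w
        using free_basis_hom_eq[OF F grp(1) comp id _ that] by blast
      then show "carrier F \<subseteq> \<sigma> ` carrier F"
        using hom_in_carrier[OF \<tau>(1)] by (metis image_eqI subsetI)
    qed
    \<comment> \<open>A right inverse gives surjectivity only; the Hopf property supplies the
      rest.\<close>
    have "inj_on \<sigma> (carrier F)" by (rule free_basis_hopfian[OF F _ \<sigma>(1) surj]) simp
    \<comment> \<open>Members of \<open>auto F\<close> are extensional, so \<open>\<sigma>\<close>
      must be restricted to the carrier.\<close>
    define \<rho> where "\<rho> = restrict \<sigma> (carrier F)"
    have \<rho>: "\<rho> w = \<sigma> w" if "w \<in> carrier F" for w using that by (simp add: \<rho>_def)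
    have "\<rho> \<in> auto F"
    proof -
      have "\<rho> \<in> hom F F" using \<sigma>(1) by (auto simp: hom_def \<rho>_def)
      moreover have "bij_betw \<rho> (carrier F) (carrier F)"
        using \<open>inj_on \<sigma> (carrier F)\<close> surj by (simp add: \<rho>_def bij_betw_def)
      ultimately show ?thesis by (simp add: auto_def Bij_def \<rho>_def)
    qed
    moreover have "\<rho> (prod_squares F x g) = prod_squares F x g"
    proof -
      define w where "w = sqprod (\<lambda>i. [(i, True)]) g"
      have lw: "letters w \<subseteq> {1..g}" by (auto simp: w_def letters_sqprod)
      have sqw: "prod_squares F f g = val F f w" if "\<And>i. i \<in> {1..g} \<Longrightarrow> f i \<in> carrier F" for f
      proof -
        have "val F f w = prod_squares F (\<lambda>i. val F f [(i, True)]) g"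
          unfolding w_def using that by (intro F.val_sqprod) auto
        also have "\<dots> = prod_squares F f g"
          unfolding prod_squares_def using that by (intro ordered_prod_cong) simp
        finally show ?thesis by simp
      qed
      have "prod_squares F x g = val F x w" using xF by (rule sqw)
      also have "\<dots> = val F x' w" using lw by (intro val_cong) (auto simp: x'_def)
      finally have px: "prod_squares F x g = val F x' w" .
      have "\<rho> (val F x' w) = \<sigma> (val F x' w)" by (rule \<rho>) (rule F.val_closed[OF x'c])
      also have "\<dots> = val F q w" by (rule \<sigma>_val[OF lw])
      also have "\<dots> = prod_squares F q g" using q by (intro sqw[symmetric])
      also have "\<dots> = val F x' (sqprod J g)"
        unfolding q_def by (rule F.val_sqprod[symmetric]) (rule x'c)
      also have "\<dots> = val F x' w" unfolding w_def by (rule F.val_feq[OF sq x'])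
      finally show ?thesis by (simp add: px)
    qed
    moreover have "\<phi> w = \<phi>\<^sub>0 (\<rho> w)" if w: "w \<in> carrier F" for w
    proof -
      have comp: "(\<lambda>w. \<phi>\<^sub>0 (\<sigma> w)) \<in> hom F H" using hom_compose[OF \<sigma>(1) \<phi>\<^sub>0(1)] by (simp add: comp_def)
      have "\<phi> b = \<phi>\<^sub>0 (\<sigma> b)" if b: "b \<in> x ` {1..g}" for b
      proof -
        obtain i where i: "b = x i" "i \<in> {1..g}" using b by blast
        have "\<phi>\<^sub>0 (q i) = val H (\<lambda>i. \<phi>\<^sub>0 (x' i)) (J i)"
          unfolding q_def by (rule hom_val[OF grp \<phi>\<^sub>0(1) x'c])
        also have "\<dots> = val H (\<lambda>i. a i [^]\<^bsub>H\<^esub> n i) (J i)"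
          using J[OF i(2)] \<phi>\<^sub>0(2) by (intro val_cong) (auto simp: x'_def)
        finally show ?thesis using i \<phi>_J \<sigma>(2) by simp
      qed
      then have "\<phi> w = \<phi>\<^sub>0 (\<sigma> w)" by (rule free_basis_hom_eq[OF F grp(2) \<phi>_hom comp _ w])
      then show ?thesis using \<rho>[OF w] by simp
    qed
    ultimately show ?thesis unfolding same_stabilizer_class_def by blast
  qed
  with sol \<phi>\<^sub>0(2) show ?thesis by blast
qed

end
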